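(* Let $S$ be a finite set, let $\lambda\in FL(S)^S$, let $t$ be a scalar-valued formal variable, and let $\Gamma_t(\lambda)\in FL(S)^S$ be the (unique) solution of the ordinary differential equation $$\Gamma_0(\lambda)=0\qquad\text{and}\qquad\frac{d\Gamma_t(\lambda)}{dt}=\frac{\mathrm{ad}\,\Gamma_t(\lambda)}{e^{\mathrm{ad}\,\Gamma_t(\lambda)}-1}\left(e^{-t\partial_\lambda}(\lambda)\right).$$ Then $e^{-t\partial_\lambda}=C^{\Gamma_t(\lambda)}$ as automorphisms of $FL(S)$.
   Context: Everything is over $\mathbb Q$. $FL(S)$ is the degree-completed free Lie algebra on the finite set $S$ of degree 1 generators, and $FL(S)^S$ is the set of functions $\lambda=(\lambda_a)_{a\in S}$ with $\lambda_a\in FL(S)$, with the componentwise (direct sum) Lie bracket, with respect to which $\mathrm{ad}$ is taken. For $\lambda\in FL(S)^S$, $\partial_\lambda$ is the unique (continuous) derivation of $FL(S)$ with $\partial_\lambda(a)=[a,\lambda_a]$ for every $a\in S$; it acts on $FL(S)^S$ componentwise. For $\mu\in FL(S)^S$, $C^\mu$ is the automorphism of $FL(S)$ defined on generators by $C^\mu(a)=e^{\mu_a}ae^{-\mu_a}=e^{\mathrm{ad}\,\mu_a}(a)$. Elements depending on $t$ have, in each degree, coefficients that are power series (in fact polynomials) in $t$. *)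

theory Defs
  imports
    "HOL-Computational_Algebra.Formal_Power_Series"
    "HOL-Library.FuncSet"
begin

section \<open>The degree-completed free Lie algebra over the rationals\<close>

text \<open>
  The free Lie algebra is the free non-associative algebra (with basis the non-associative
  monomials in the generators) modulo the two-sided ideal generated by all \<open>f f\<close> and all Jacobi
  expressions. Elements of the non-associative algebra and of its degree completion are given by
  their coefficient functions.
\<close>

datatype 'a monomial = Gen 'a | Mul "'a monomial" "'a monomial"

primrec deg :: "'a monomial \<Rightarrow> nat" where
  "deg (Gen a) = 1"
| "deg (Mul u v) = deg u + deg v"

definition finsupp :: "('a monomial \<Rightarrow> rat) \<Rightarrow> bool" where
  "finsupp f \<longleftrightarrow> finite {m. f m \<noteq> 0}"

definition degfin :: "('a monomial \<Rightarrow> rat) \<Rightarrow> bool" where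
  "degfin f \<longleftrightarrow> (\<forall>n. finite {m. deg m = n \<and> f m \<noteq> 0})"

definition hom_part :: "nat \<Rightarrow> ('a monomial \<Rightarrow> rat) \<Rightarrow> 'a monomial \<Rightarrow> rat" where
  "hom_part n f = (\<lambda>m. if deg m = n then f m else 0)"

primrec na_mult :: "('a monomial \<Rightarrow> rat) \<Rightarrow> ('a monomial \<Rightarrow> rat) \<Rightarrow> 'a monomial \<Rightarrow> rat" where
  "na_mult f g (Gen a) = 0"
| "na_mult f g (Mul u v) = f u * g v"

inductive_set lie_ideal :: "('a monomial \<Rightarrow> rat) set" where
  zero: "(\<lambda>m. 0) \<in> lie_ideal"
| add: "f \<in> lie_ideal \<Longrightarrow> g \<in> lie_ideal \<Longrightarrow> (\<lambda>m. f m + g m) \<in> lie_ideal"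
| scale: "f \<in> lie_ideal \<Longrightarrow> (\<lambda>m. c * f m) \<in> lie_ideal"
| mult_left: "finsupp f \<Longrightarrow> g \<in> lie_ideal \<Longrightarrow> na_mult f g \<in> lie_ideal"
| mult_right: "f \<in> lie_ideal \<Longrightarrow> finsupp g \<Longrightarrow> na_mult f g \<in> lie_ideal"
| alternating: "finsupp f \<Longrightarrow> na_mult f f \<in> lie_ideal"
| jacobi: "finsupp f \<Longrightarrow> finsupp g \<Longrightarrow> finsupp h \<Longrightarrow>
    (\<lambda>m. na_mult f (na_mult g h) m + na_mult g (na_mult h f) m + na_mult h (na_mult f g) m)
      \<in> lie_ideal"

definition lie_ideal_closure :: "('a monomial \<Rightarrow> rat) set" where
  "lie_ideal_closure = {f. \<forall>n. hom_part n f \<in> lie_ideal}"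

definition lie_eq :: "('a monomial \<Rightarrow> rat) \<Rightarrow> ('a monomial \<Rightarrow> rat) \<Rightarrow> bool" where
  "lie_eq f g \<longleftrightarrow> degfin f \<and> degfin g \<and> (\<lambda>m. f m - g m) \<in> lie_ideal_closure"

lemma hom_part_simps:
  "hom_part n (\<lambda>m. 0) = (\<lambda>m. 0)"
  "hom_part n (\<lambda>m. f m + g m) = (\<lambda>m. hom_part n f m + hom_part n g m)"
  "hom_part n (\<lambda>m. c * f m) = (\<lambda>m. c * hom_part n f m)"
  by (auto simp: hom_part_def)

lemma closure_zero: "(\<lambda>m. 0) \<in> lie_ideal_closure"
  by (simp add: lie_ideal_closure_def hom_part_simps lie_ideal.zero)

lemma closure_add:
  "f \<in> lie_ideal_closure \<Longrightarrow> g \<in> lie_ideal_closure \<Longrightarrow> (\<lambda>m. f m + g m) \<in> lie_ideal_closure"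
  by (simp add: lie_ideal_closure_def hom_part_simps lie_ideal.add)

lemma closure_scale: "f \<in> lie_ideal_closure \<Longrightarrow> (\<lambda>m. c * f m) \<in> lie_ideal_closure"
  by (simp add: lie_ideal_closure_def hom_part_simps lie_ideal.scale)

lemma degfin_zero: "degfin (\<lambda>m. 0)"
  by (simp add: degfin_def)

lemma degfin_add: "degfin f \<Longrightarrow> degfin g \<Longrightarrow> degfin (\<lambda>m. f m + g m)"
  unfolding degfin_def
proof
  fix n
  assume "\<forall>n. finite {m. deg m = n \<and> f m \<noteq> 0}" "\<forall>n. finite {m. deg m = n \<and> g m \<noteq> 0}"
  then have "finite ({m. deg m = n \<and> f m \<noteq> 0} \<union> {m. deg m = n \<and> g m \<noteq> 0})" by blast
  then show "finite {m. deg m = n \<and> f m + g m \<noteq> 0}"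
    by (rule rev_finite_subset) auto
qed

lemma degfin_scale: "degfin f \<Longrightarrow> degfin (\<lambda>m. c * f m)"
  unfolding degfin_def by (auto intro: rev_finite_subset)

lemma finsupp_hom_part: "degfin f \<Longrightarrow> finsupp (hom_part n f)"
  unfolding degfin_def finsupp_def hom_part_def by (auto intro: rev_finite_subset)

lemma degfin_hom_part: "degfin f \<Longrightarrow> degfin (hom_part n f)"
  unfolding degfin_def hom_part_def by (auto intro: rev_finite_subset)

lemma finite_deg_le: "degfin f \<Longrightarrow> finite {m. deg m \<le> n \<and> f m \<noteq> 0}"
proof -
  assume "degfin f"
  then have "finite (\<Union>k\<in>{..n}. {m. deg m = k \<and> f m \<noteq> 0})" by (auto simp: degfin_def)
  then show ?thesis by (rule rev_finite_subset) auto
qed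

lemma degfin_mult:
  assumes "degfin f" "degfin g"
  shows "degfin (na_mult f g)"
  unfolding degfin_def
proof
  fix n
  let ?A = "{m. deg m \<le> n \<and> f m \<noteq> 0}" and ?B = "{m. deg m \<le> n \<and> g m \<noteq> 0}"
  have "finite ((\<lambda>(u, v). Mul u v) ` (?A \<times> ?B))"
    using assms by (intro finite_imageI finite_cartesian_product finite_deg_le)
  moreover have "{m. deg m = n \<and> na_mult f g m \<noteq> 0} \<subseteq> (\<lambda>(u, v). Mul u v) ` (?A \<times> ?B)"
  proof
    fix m assume "m \<in> {m. deg m = n \<and> na_mult f g m \<noteq> 0}"
    then show "m \<in> (\<lambda>(u, v). Mul u v) ` (?A \<times> ?B)"
      by (cases m) (auto simp: image_iff)
  qed
  ultimately show "finite {m. deg m = n \<and> na_mult f g m \<noteq> 0}"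
    by (rule rev_finite_subset)
qed

lemma lie_ideal_sum:
  "finite A \<Longrightarrow> (\<And>i. i \<in> A \<Longrightarrow> F i \<in> lie_ideal) \<Longrightarrow> (\<lambda>m. \<Sum>i\<in>A. F i m) \<in> lie_ideal"
  by (induction A rule: finite_induct) (auto intro: lie_ideal.zero lie_ideal.add)

lemma hom_part_mult:
  "hom_part n (na_mult f g) = (\<lambda>m. \<Sum>i\<in>{..n}. na_mult (hom_part i f) (hom_part (n - i) g) m)"
proof
  fix m
  show "hom_part n (na_mult f g) m
      = (\<Sum>i\<in>{..n}. na_mult (hom_part i f) (hom_part (n - i) g) m)"
  proof (cases m)
    case (Gen a)
    then show ?thesis by (simp add: hom_part_def)
  next
    case (Mul u v)
    have "(\<Sum>i\<in>{..n}. hom_part i f u * hom_part (n - i) g v)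
        = (\<Sum>i\<in>{..n}. if i = deg u then hom_part n (na_mult f g) m else 0)"
      by (rule sum.cong) (auto simp: hom_part_def Mul)
    also have "\<dots> = hom_part n (na_mult f g) m"
      by (auto simp: hom_part_def Mul)
    finally show ?thesis by (simp add: Mul)
  qed
qed

lemma closure_mult_left:
  "degfin f \<Longrightarrow> g \<in> lie_ideal_closure \<Longrightarrow> na_mult f g \<in> lie_ideal_closure"
  unfolding lie_ideal_closure_def
  by (auto simp: hom_part_mult intro!: lie_ideal_sum lie_ideal.mult_left finsupp_hom_part)

lemma closure_mult_right:
  "f \<in> lie_ideal_closure \<Longrightarrow> degfin g \<Longrightarrow> na_mult f g \<in> lie_ideal_closure"
  unfolding lie_ideal_closure_def
  by (auto simp: hom_part_mult intro!: lie_ideal_sum lie_ideal.mult_right finsupp_hom_part)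

lemma lie_eq_refl: "degfin f \<Longrightarrow> lie_eq f f"
  by (simp add: lie_eq_def closure_zero)

lemma lie_eq_sym: "lie_eq f g \<Longrightarrow> lie_eq g f"
  unfolding lie_eq_def using closure_scale[of "\<lambda>m. f m - g m" "-1"] by simp

lemma lie_eq_trans: "lie_eq f g \<Longrightarrow> lie_eq g h \<Longrightarrow> lie_eq f h"
  unfolding lie_eq_def using closure_add[of "\<lambda>m. f m - g m" "\<lambda>m. g m - h m"] by simp

text \<open>
  For an arbitrary type of letters, \<open>'a fl\<close> is the product over all degrees of the homogeneous
  parts of the free Lie algebra on \<open>'a\<close>.
\<close>

quotient_type 'a fl = "'a monomial \<Rightarrow> rat" / partial: lie_eq
proof (rule part_equivpI)
  show "\<exists>f :: 'a monomial \<Rightarrow> rat. lie_eq f f" using lie_eq_refl degfin_zero by blast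
  show "symp (lie_eq :: ('a monomial \<Rightarrow> rat) \<Rightarrow> _)" by (rule sympI) (rule lie_eq_sym)
  show "transp (lie_eq :: ('a monomial \<Rightarrow> rat) \<Rightarrow> _)" by (rule transpI) (rule lie_eq_trans)
qed

instantiation fl :: (type) ab_group_add
begin

lift_definition zero_fl :: "'a fl" is "\<lambda>m. 0"
  by (rule lie_eq_refl[OF degfin_zero])

lift_definition plus_fl :: "'a fl \<Rightarrow> 'a fl \<Rightarrow> 'a fl" is "\<lambda>f g m. f m + g m"
  subgoal for f f' g g'
    unfolding lie_eq_def
    using closure_add[of "\<lambda>m. f m - f' m" "\<lambda>m. g m - g' m"]
    by (auto simp: degfin_add algebra_simps)
  done

lift_definition uminus_fl :: "'a fl \<Rightarrow> 'a fl" is "\<lambda>f m. - f m"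
  subgoal for f g
    unfolding lie_eq_def
    using closure_scale[of "\<lambda>m. f m - g m" "-1"] degfin_scale[of f "-1"] degfin_scale[of g "-1"]
    by simp
  done

definition minus_fl :: "'a fl \<Rightarrow> 'a fl \<Rightarrow> 'a fl" where "minus_fl x y = x + - y"

instance
proof
  fix x y z :: "'a fl"
  show "x + y + z = x + (y + z)"
    by transfer (auto simp: add.assoc intro!: lie_eq_refl degfin_add simp: lie_eq_def)
  show "x + y = y + x"
    by transfer (auto simp: lie_eq_def degfin_add add.commute closure_zero)
  show "0 + x = x" by transfer simp
  show "- x + x = 0"
    by transfer (simp add: lie_eq_refl degfin_zero)
  show "x - y = x + - y" by (rule minus_fl_def)
qed

end

lift_definition fl_scale :: "rat \<Rightarrow> 'a fl \<Rightarrow> 'a fl" is "\<lambda>c f m. c * f m"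
  subgoal for c f g
    unfolding lie_eq_def
    using closure_scale[of "\<lambda>m. f m - g m" c]
    by (auto simp: degfin_scale right_diff_distrib)
  done

lift_definition fl_bracket :: "'a fl \<Rightarrow> 'a fl \<Rightarrow> 'a fl" is na_mult
  subgoal for f f' g g'
  proof -
    assume a: "lie_eq f f'" "lie_eq g g'"
    have "(\<lambda>m. na_mult f g m - na_mult f' g' m)
        = (\<lambda>m. na_mult (\<lambda>m. f m - f' m) g m + na_mult f' (\<lambda>m. g m - g' m) m)"
    proof
      fix m
      show "na_mult f g m - na_mult f' g' m
          = na_mult (\<lambda>m. f m - f' m) g m + na_mult f' (\<lambda>m. g m - g' m) m"
        by (cases m) (auto simp: algebra_simps)
    qed
    with a show ?thesis
      unfolding lie_eq_def
      by (simp add: degfin_mult closure_add closure_mult_left closure_mult_right)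
  qed
  done

lift_definition fl_gen :: "'a \<Rightarrow> 'a fl" is "\<lambda>a m. if m = Gen a then 1 else 0"
  by (rule lie_eq_refl) (auto simp: degfin_def)

lift_definition fl_part :: "nat \<Rightarrow> 'a fl \<Rightarrow> 'a fl" is hom_part
  subgoal for n f g
  proof -
    assume a: "lie_eq f g"
    have "hom_part k (\<lambda>m. hom_part n f m - hom_part n g m)
        = (if k = n then hom_part n (\<lambda>m. f m - g m) else (\<lambda>m. 0))" for k
      by (auto simp: hom_part_def)
    with a show ?thesis
      unfolding lie_eq_def lie_ideal_closure_def
      by (auto simp: degfin_hom_part lie_ideal.zero)
  qed
  done

lemma fl_bracket_self: "fl_bracket x x = 0"
proof transfer
  fix f :: "'a monomial \<Rightarrow> rat"
  assume "lie_eq f f"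
  then have df: "degfin f" by (simp add: lie_eq_def)
  have sq: "(\<lambda>m. na_mult g h m + na_mult h g m) \<in> lie_ideal"
    if "finsupp g" "finsupp h" for g h :: "'a monomial \<Rightarrow> rat"
  proof -
    have fs: "finsupp (\<lambda>m. g m + h m)"
      using that unfolding finsupp_def
      by (auto intro: rev_finite_subset[of "{m. g m \<noteq> 0} \<union> {m. h m \<noteq> 0}"])
    have "(\<lambda>m. na_mult g h m + na_mult h g m)
        = (\<lambda>m. (na_mult (\<lambda>m. g m + h m) (\<lambda>m. g m + h m) m + (-1) * na_mult g g m)
            + (-1) * na_mult h h m)"
    proof
      fix m
      show "na_mult g h m + na_mult h g m
        = (na_mult (\<lambda>m. g m + h m) (\<lambda>m. g m + h m) m + (-1) * na_mult g g m)
            + (-1) * na_mult h h m"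
        by (cases m) (auto simp: algebra_simps)
    qed
    then show ?thesis
      using that fs by (auto intro!: lie_ideal.add lie_ideal.scale lie_ideal.alternating
          simp del: mult_minus1 mult_minus_left)
  qed
  have "hom_part n (na_mult f f) \<in> lie_ideal" for n
  proof -
    let ?P = "\<lambda>i. na_mult (hom_part i f) (hom_part (n - i) f)"
    have "hom_part n (na_mult f f) = (\<lambda>m. (1/2) * (\<Sum>i\<in>{..n}. ?P i m + ?P (n - i) m))"
    proof
      fix m
      have "(\<Sum>i\<in>{..n}. ?P (n - i) m) = (\<Sum>i\<in>{..n}. ?P i m)"
        using sum.nat_diff_reindex[of "\<lambda>i. ?P i m" "Suc n"] by (simp add: lessThan_Suc_atMost)
      then show "hom_part n (na_mult f f) m = (1/2) * (\<Sum>i\<in>{..n}. ?P i m + ?P (n - i) m)"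
        by (simp add: hom_part_mult sum.distrib)
    qed
    moreover have "(\<lambda>m. (1/2) * (\<Sum>i\<in>{..n}. ?P i m + ?P (n - i) m)) \<in> lie_ideal"
    proof (intro lie_ideal.scale lie_ideal_sum)
      fix i assume "i \<in> {..n}"
      then show "(\<lambda>m. ?P i m + ?P (n - i) m) \<in> lie_ideal"
        using sq[OF finsupp_hom_part[OF df] finsupp_hom_part[OF df], of i "n - i"] by simp
    qed simp
    ultimately show ?thesis by simp
  qed
  then show "lie_eq (na_mult f f) (\<lambda>m. 0)"
    by (simp add: lie_eq_def degfin_mult degfin_zero df lie_ideal_closure_def)
qed

lemma fl_jacobi:
  "fl_bracket x (fl_bracket y z) + fl_bracket y (fl_bracket z x) + fl_bracket z (fl_bracket x y) = 0"
proof transfer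
  fix f g h :: "'a monomial \<Rightarrow> rat"
  assume "lie_eq f f" "lie_eq g g" "lie_eq h h"
  then have df: "degfin f" "degfin g" "degfin h" by (simp_all add: lie_eq_def)
  define T :: "nat \<Rightarrow> (nat \<times> nat \<times> nat) set" where "T n = {(i, j, k). i + j + k = n}" for n
  have finT: "finite (T n)" for n
    by (rule finite_subset[of _ "{..n} \<times> {..n} \<times> {..n}"]) (auto simp: T_def)
  let ?N = "\<lambda>p q r (i, j, k). na_mult (hom_part i p) (na_mult (hom_part j q) (hom_part k r))"
  have expand: "hom_part n (na_mult p (na_mult q r)) m = (\<Sum>t\<in>T n. ?N p q r t m)"
    for n m and p q r :: "'a monomial \<Rightarrow> rat"
  proof (cases "\<exists>u v w. m = Mul u (Mul v w)")
    case False
    then have "na_mult p (na_mult q r) m = 0" for p q r :: "'a monomial \<Rightarrow> rat"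
      by (metis mult_zero_right na_mult.simps monomial.exhaust)
    then show ?thesis by (simp add: hom_part_def case_prod_unfold)
  next
    case True
    then obtain u v w where m: "m = Mul u (Mul v w)" by blast
    have "(\<Sum>t\<in>T n. ?N p q r t m)
        = (\<Sum>t\<in>T n. if t = (deg u, deg v, deg w) then hom_part n (na_mult p (na_mult q r)) m else 0)"
      by (rule sum.cong) (auto simp: hom_part_def m T_def split: if_splits)
    also have "\<dots> = hom_part n (na_mult p (na_mult q r)) m"
      using finT by (auto simp: T_def hom_part_def m)
    finally show ?thesis by simp
  qed
  have rot: "(\<Sum>t\<in>T n. F t) = (\<Sum>(i, j, k)\<in>T n. F (j, k, i))" for n and F :: "_ \<Rightarrow> rat"
    by (rule sum.reindex_bij_witness[of _ "\<lambda>(i, j, k). (j, k, i)" "\<lambda>(j, k, i). (i, j, k)"])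
      (auto simp: T_def)
  let ?J = "\<lambda>m. na_mult f (na_mult g h) m + na_mult g (na_mult h f) m + na_mult h (na_mult f g) m"
  have "hom_part n ?J \<in> lie_ideal" for n
  proof -
    let ?K = "\<lambda>t m. ?N f g h t m + (case t of (i, j, k) \<Rightarrow> ?N g h f (j, k, i) m)
        + (case t of (i, j, k) \<Rightarrow> ?N h f g (k, i, j) m)"
    have "hom_part n ?J = (\<lambda>m. \<Sum>t\<in>T n. ?K t m)"
    proof
      fix m
      have "(\<Sum>t\<in>T n. ?N g h f t m) = (\<Sum>t\<in>T n. case t of (i, j, k) \<Rightarrow> ?N g h f (j, k, i) m)"
        by (subst rot) simp
      moreover have "(\<Sum>t\<in>T n. ?N h f g t m)
          = (\<Sum>t\<in>T n. case t of (i, j, k) \<Rightarrow> ?N h f g (k, i, j) m)"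
        by (subst rot, subst rot) (simp add: case_prod_unfold)
      ultimately show "hom_part n ?J m = (\<Sum>t\<in>T n. ?K t m)"
        by (simp only: hom_part_simps expand sum.distrib)
    qed
    moreover have "(\<lambda>m. \<Sum>t\<in>T n. ?K t m) \<in> lie_ideal"
    proof (rule lie_ideal_sum[OF finT])
      fix t assume "t \<in> T n"
      obtain i j k where "t = (i, j, k)" by (cases t)
      then show "?K t \<in> lie_ideal"
        using lie_ideal.jacobi[OF df[THEN finsupp_hom_part], of i j k] by simp
    qed
    ultimately show ?thesis by simp
  qed
  then show "lie_eq ?J (\<lambda>m. 0)"
    by (simp add: lie_eq_def degfin_add degfin_mult degfin_zero df lie_ideal_closure_def)
qed

text \<open>
  \<open>FL S\<close> is the completed free Lie algebra on \<open>S\<close>: the classes of series in monomials over \<open>S\<close>.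
  (Killing the letters outside \<open>S\<close> is a retraction that preserves the defining ideal, so no
  relations beyond those of the free Lie algebra on \<open>S\<close> are imposed.)
\<close>

definition FL :: "'a set \<Rightarrow> 'a fl set" where
  "FL S = {abs_fl f | f. degfin f \<and> (\<forall>m. f m \<noteq> 0 \<longrightarrow> set_monomial m \<subseteq> S)}"

section \<open>Derivations\<close>

definition fl_continuous :: "'a set \<Rightarrow> ('a fl \<Rightarrow> 'a fl) \<Rightarrow> bool" where
  "fl_continuous S F \<longleftrightarrow> (\<forall>n. \<exists>d. \<forall>x\<in>FL S. \<forall>y\<in>FL S.
     (\<forall>k\<le>d. fl_part k x = fl_part k y) \<longrightarrow> (\<forall>k\<le>n. fl_part k (F x) = fl_part k (F y)))"

definition fl_derivation :: "'a set \<Rightarrow> ('a fl \<Rightarrow> 'a fl) \<Rightarrow> bool" where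
  "fl_derivation S D \<longleftrightarrow> D \<in> FL S \<rightarrow>\<^sub>E FL S \<and> fl_continuous S D
     \<and> (\<forall>x\<in>FL S. \<forall>y\<in>FL S. D (x + y) = D x + D y)
     \<and> (\<forall>c. \<forall>x\<in>FL S. D (fl_scale c x) = fl_scale c (D x))
     \<and> (\<forall>x\<in>FL S. \<forall>y\<in>FL S. D (fl_bracket x y) = fl_bracket (D x) y + fl_bracket x (D y))"

definition tder :: "'a set \<Rightarrow> ('a \<Rightarrow> 'a fl) \<Rightarrow> 'a fl \<Rightarrow> 'a fl" where
  "tder S lam = (THE D. fl_derivation S D
     \<and> (\<forall>a\<in>S. D (fl_gen a) = fl_bracket (fl_gen a) (lam a)))"

section \<open>Elements depending on t\<close>

text \<open>
  The homogeneous parts of \<open>FL S\<close> are finite-dimensional for finite \<open>S\<close>, so an element of \<open>FL S\<close>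
  with coefficients in each degree that are power series in \<open>t\<close> is the same as a power series in
  \<open>t\<close> with coefficients in \<open>FL S\<close>. It is represented as an \<open>'a fl fps\<close>, whose variable is \<open>t\<close>.
\<close>

definition FLt :: "'a set \<Rightarrow> 'a fl fps set" where
  "FLt S = {x. \<forall>k. fps_nth x k \<in> FL S}"

definition flt_scale :: "rat fps \<Rightarrow> 'a fl fps \<Rightarrow> 'a fl fps" where
  "flt_scale c x = Abs_fps (\<lambda>n. \<Sum>i\<le>n. fl_scale (fps_nth c i) (fps_nth x (n - i)))"

definition flt_bracket :: "'a fl fps \<Rightarrow> 'a fl fps \<Rightarrow> 'a fl fps" where
  "flt_bracket x y = Abs_fps (\<lambda>n. \<Sum>i\<le>n. fl_bracket (fps_nth x i) (fps_nth y (n - i)))"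

abbreviation flt_ad :: "'a fl fps \<Rightarrow> 'a fl fps \<Rightarrow> 'a fl fps" where
  "flt_ad x \<equiv> flt_bracket x"

definition flt_map :: "('a fl \<Rightarrow> 'a fl) \<Rightarrow> 'a fl fps \<Rightarrow> 'a fl fps" where
  "flt_map F x = Abs_fps (\<lambda>k. F (fps_nth x k))"

abbreviation flt_part :: "nat \<Rightarrow> 'a fl fps \<Rightarrow> 'a fl fps" where
  "flt_part n \<equiv> flt_map (fl_part n)"

definition ddt :: "'a fl fps \<Rightarrow> 'a fl fps" where
  "ddt x = Abs_fps (\<lambda>k. fl_scale (of_nat (Suc k)) (fps_nth x (Suc k)))"

text \<open>Convergence of a series degree by degree.\<close>

definition flt_sums :: "(nat \<Rightarrow> 'a fl fps) \<Rightarrow> 'a fl fps \<Rightarrow> bool" where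
  "flt_sums s y \<longleftrightarrow>
     (\<forall>n. eventually (\<lambda>N. flt_part n (\<Sum>k<N. s k) = flt_part n y) sequentially)"

text \<open>The operator \<open>p(T)\<close> for a scalar power series \<open>p\<close>.\<close>

definition op_series :: "rat fps \<Rightarrow> ('a fl fps \<Rightarrow> 'a fl fps) \<Rightarrow> 'a fl fps \<Rightarrow> 'a fl fps" where
  "op_series p T x = (THE y. flt_sums (\<lambda>k. flt_scale (fps_const (fps_nth p k)) ((T ^^ k) x)) y)"

abbreviation op_exp :: "('a fl fps \<Rightarrow> 'a fl fps) \<Rightarrow> 'a fl fps \<Rightarrow> 'a fl fps" where
  "op_exp \<equiv> op_series (fps_exp 1)"

section \<open>Automorphisms\<close>

definition flt_continuous :: "'a set \<Rightarrow> ('a fl fps \<Rightarrow> 'a fl fps) \<Rightarrow> bool" where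
  "flt_continuous S F \<longleftrightarrow> (\<forall>n. \<exists>d. \<forall>x\<in>FLt S. \<forall>y\<in>FLt S.
     (\<forall>k\<le>d. flt_part k x = flt_part k y) \<longrightarrow> (\<forall>k\<le>n. flt_part k (F x) = flt_part k (F y)))"

text \<open>
  An automorphism depending on \<open>t\<close> is an automorphism of the Lie algebra \<open>FLt S\<close> over the ring of
  power series in \<open>t\<close>.
\<close>

definition flt_automorphism :: "'a set \<Rightarrow> ('a fl fps \<Rightarrow> 'a fl fps) \<Rightarrow> bool" where
  "flt_automorphism S F \<longleftrightarrow> F \<in> FLt S \<rightarrow>\<^sub>E FLt S \<and> bij_betw F (FLt S) (FLt S)
     \<and> flt_continuous S F
     \<and> (\<forall>x\<in>FLt S. \<forall>y\<in>FLt S. F (x + y) = F x + F y)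
     \<and> (\<forall>c. \<forall>x\<in>FLt S. F (flt_scale c x) = flt_scale c (F x))
     \<and> (\<forall>x\<in>FLt S. \<forall>y\<in>FLt S. F (flt_bracket x y) = flt_bracket (F x) (F y))"

definition C_aut :: "'a set \<Rightarrow> ('a \<Rightarrow> 'a fl fps) \<Rightarrow> 'a fl fps \<Rightarrow> 'a fl fps" where
  "C_aut S mu = (THE F. flt_automorphism S F
     \<and> (\<forall>a\<in>S. F (fps_const (fl_gen a)) = op_exp (flt_ad (mu a)) (fps_const (fl_gen a))))"

text \<open>\<open>e\<^sup>-\<^sup>t\<^sup>\<partial>\<close>, with the derivation extended linearly over the power series in \<open>t\<close>.\<close>

definition exp_neg_t_tder :: "'a set \<Rightarrow> ('a \<Rightarrow> 'a fl) \<Rightarrow> 'a fl fps \<Rightarrow> 'a fl fps" where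
  "exp_neg_t_tder S lam =
     restrict (op_exp (\<lambda>x. flt_scale (- fps_X) (flt_map (tder S lam) x))) (FLt S)"

section \<open>The differential equation\<close>

text \<open>
  The bracket on tuples indexed by \<open>S\<close> is componentwise, hence so is a power series in \<open>ad\<close>
  of a tuple.
\<close>

definition Gamma_ODE :: "'a set \<Rightarrow> ('a \<Rightarrow> 'a fl) \<Rightarrow> ('a \<Rightarrow> 'a fl fps) \<Rightarrow> bool" where
  "Gamma_ODE S lam G \<longleftrightarrow> (\<forall>a\<in>S. fps_nth (G a) 0 = 0
     \<and> ddt (G a) = op_series (fps_X / (fps_exp 1 - 1)) (flt_ad (G a))
         (exp_neg_t_tder S lam (fps_const (lam a))))"

definition Gamma_sol :: "'a set \<Rightarrow> ('a \<Rightarrow> 'a fl) \<Rightarrow> 'a \<Rightarrow> 'a fl fps" where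
  "Gamma_sol S lam = (THE G. G \<in> S \<rightarrow>\<^sub>E FLt S \<and> Gamma_ODE S lam G)"

end

theory Submission
  imports Defs
begin

text \<open>
  Fix a generator \<open>a\<close> and write \<open>E = exp (-t \<partial>)\<close> and \<open>g = \<Gamma> a\<close>. Differentiating in \<open>t\<close> gives
  \<open>d/dt (E a) = - E [a, \<lambda> a] = [E (\<lambda> a), E a]\<close>, since \<open>E\<close> is a Lie automorphism commuting with
  \<open>\<partial>\<close>. On the other side, \<open>d/dt (exp (ad g) a) = [\<phi> (ad g) (dg/dt), exp (ad g) a]\<close> with
  \<open>\<phi> (z) = (exp z - 1) / z\<close>, and the equation for \<open>\<Gamma>\<close> says precisely that
  \<open>\<phi> (ad g) (dg/dt) = E (\<lambda> a)\<close>. Thus \<open>E a\<close> and \<open>exp (ad g) a\<close> solve the same linear equation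
  with the same initial value \<open>a\<close>. A continuous automorphism is determined by its values on the
  generators.
\<close>

section \<open>The completed free Lie algebra\<close>

lemma abs_fl_eqI: "lie_eq f g \<Longrightarrow> abs_fl f = abs_fl g"
  by (rule Quotient_rel_abs[OF Quotient_fl])

lemma abs_fl_eq_iff: "degfin f \<Longrightarrow> degfin g \<Longrightarrow> abs_fl f = abs_fl g \<longleftrightarrow> lie_eq f g"
  using Quotient_rel[OF Quotient_fl, of f g] lie_eq_refl by blast

lemma lie_eq_self [simp]: "lie_eq f f \<longleftrightarrow> degfin f"
  by (auto simp: lie_eq_def closure_zero)

lemma fl_cases: obtains f where "degfin f" "x = abs_fl f"
  by (metis Quotient_abs_rep[OF Quotient_fl] Quotient_rep_reflp[OF Quotient_fl] lie_eq_self)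

interpretation fl: vector_space fl_scale
proof
  fix a b :: rat and x y :: "'a fl"
  show "fl_scale a (x + y) = fl_scale a x + fl_scale a y"
    by transfer (simp add: distrib_left degfin_add degfin_scale)
  show "fl_scale (a + b) x = fl_scale a x + fl_scale b x"
    by transfer (simp add: distrib_right degfin_add degfin_scale)
  show "fl_scale a (fl_scale b x) = fl_scale (a * b) x"
    by transfer (simp add: mult.assoc degfin_scale)
  show "fl_scale 1 x = x"
    by transfer simp
qed

lemma na_mult_add_left: "na_mult (\<lambda>m. f m + g m) h = (\<lambda>m. na_mult f h m + na_mult g h m)"
proof
  show "na_mult (\<lambda>m. f m + g m) h m = na_mult f h m + na_mult g h m" for m
    by (cases m) (auto simp: algebra_simps)
qed

lemma na_mult_add_right: "na_mult h (\<lambda>m. f m + g m) = (\<lambda>m. na_mult h f m + na_mult h g m)"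
proof
  show "na_mult h (\<lambda>m. f m + g m) m = na_mult h f m + na_mult h g m" for m
    by (cases m) (auto simp: algebra_simps)
qed

lemma na_mult_scale_left: "na_mult (\<lambda>m. c * f m) h = (\<lambda>m. c * na_mult f h m)"
proof
  show "na_mult (\<lambda>m. c * f m) h m = c * na_mult f h m" for m
    by (cases m) auto
qed

lemma na_mult_scale_right: "na_mult h (\<lambda>m. c * f m) = (\<lambda>m. c * na_mult h f m)"
proof
  show "na_mult h (\<lambda>m. c * f m) m = c * na_mult h f m" for m
    by (cases m) auto
qed

lemma fl_bracket_add_left: "fl_bracket (x + y) z = fl_bracket x z + fl_bracket y z"
  by transfer (simp add: na_mult_add_left degfin_add degfin_mult)

lemma fl_bracket_add_right: "fl_bracket z (x + y) = fl_bracket z x + fl_bracket z y"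
  by transfer (simp add: na_mult_add_right degfin_add degfin_mult)

lemma fl_bracket_scale_left: "fl_bracket (fl_scale c x) z = fl_scale c (fl_bracket x z)"
  by transfer (simp add: na_mult_scale_left degfin_scale degfin_mult)

lemma fl_bracket_scale_right: "fl_bracket z (fl_scale c x) = fl_scale c (fl_bracket z x)"
  by transfer (simp add: na_mult_scale_right degfin_scale degfin_mult)

interpretation fl_bracket_left: additive "\<lambda>x. fl_bracket x z" for z
  by unfold_locales (rule fl_bracket_add_left)

interpretation fl_bracket_right: additive "fl_bracket z" for z
  by unfold_locales (rule fl_bracket_add_right)

lemma fl_bracket_swap: "fl_bracket x y = - fl_bracket y x"
proof -
  have "0 = fl_bracket (x + y) (x + y)"
    by (simp only: fl_bracket_self)
  also have "\<dots> = fl_bracket x y + fl_bracket y x"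
    by (subst fl_bracket_add_left) (simp add: fl_bracket_add_right fl_bracket_self add.commute)
  finally show ?thesis
    by (metis eq_neg_iff_add_eq_0)
qed

lemma fl_bracket_derivation:
  "fl_bracket x (fl_bracket y z) = fl_bracket (fl_bracket x y) z + fl_bracket y (fl_bracket x z)"
proof -
  have "fl_bracket x (fl_bracket y z) = - fl_bracket y (fl_bracket z x) - fl_bracket z (fl_bracket x y)"
    using fl_jacobi[of x y z] by (simp add: eq_diff_eq eq_neg_iff_add_eq_0 ac_simps)
  also have "- fl_bracket y (fl_bracket z x) = fl_bracket y (fl_bracket x z)"
    using fl_bracket_swap[of x z] by (simp add: fl_bracket_right.minus)
  finally show ?thesis
    using fl_bracket_swap[of "fl_bracket x y" z] by simp
qed

lemma fl_part_add: "fl_part n (x + y) = fl_part n x + fl_part n y"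
  by transfer (simp add: hom_part_simps degfin_add degfin_hom_part)

interpretation fl_part: additive "fl_part n" for n
  by unfold_locales (rule fl_part_add)

lemma fl_part_scale: "fl_part n (fl_scale c x) = fl_scale c (fl_part n x)"
  by transfer (simp add: hom_part_simps degfin_scale degfin_hom_part)

lemma deg_pos: "0 < deg m"
  by (induction m) auto

lemma fl_part_0 [simp]: "fl_part 0 x = 0"
proof transfer
  fix f :: "'a monomial \<Rightarrow> rat"
  have "hom_part 0 f = (\<lambda>m. 0)"
    using deg_pos by (metis hom_part_def less_not_refl)
  then show "lie_eq (hom_part 0 f) (\<lambda>m. 0)"
    by (simp add: degfin_zero)
qed

lemma fl_eqI:
  assumes "\<And>n. fl_part n x = fl_part n y"
  shows "x = y"
proof -
  obtain f g where fg: "degfin f" "x = abs_fl f" "degfin g" "y = abs_fl g"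
    by (metis fl_cases)
  have "hom_part n (\<lambda>m. f m - g m) \<in> lie_ideal" for n
  proof -
    have "lie_eq (hom_part n f) (hom_part n g)"
      using assms[of n] fg by (simp add: fl_part.abs_eq degfin_hom_part abs_fl_eq_iff)
    then have "hom_part n (\<lambda>m. hom_part n f m - hom_part n g m) \<in> lie_ideal"
      by (simp add: lie_eq_def lie_ideal_closure_def)
    also have "hom_part n (\<lambda>m. hom_part n f m - hom_part n g m) = hom_part n (\<lambda>m. f m - g m)"
      by (auto simp: hom_part_def)
    finally show ?thesis .
  qed
  then have "lie_eq f g"
    using fg by (simp add: lie_eq_def lie_ideal_closure_def)
  then show ?thesis
    using fg abs_fl_eqI by blast
qed

lemma abs_fl_sum:
  assumes "finite I" "\<And>i. i \<in> I \<Longrightarrow> degfin (F i)"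
  shows "degfin (\<lambda>m. \<Sum>i\<in>I. F i m) \<and> abs_fl (\<lambda>m. \<Sum>i\<in>I. F i m) = (\<Sum>i\<in>I. abs_fl (F i))"
  using assms
proof (induction I rule: finite_induct)
  case empty
  then show ?case by (simp add: degfin_zero zero_fl_def)
next
  case (insert i I)
  then show ?case
    by (simp add: degfin_add plus_fl.abs_eq[symmetric])
qed

lemma fl_part_bracket:
  "fl_part n (fl_bracket x y) = (\<Sum>i\<le>n. fl_bracket (fl_part i x) (fl_part (n - i) y))"
proof -
  obtain f g where fg: "degfin f" "x = abs_fl f" "degfin g" "y = abs_fl g"
    by (metis fl_cases)
  then show ?thesis
    using abs_fl_sum[of "{..n}" "\<lambda>i. na_mult (hom_part i f) (hom_part (n - i) g)"]
    by (simp add: fl_part.abs_eq fl_bracket.abs_eq degfin_mult degfin_hom_part hom_part_mult)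
qed

definition fl_order_ge :: "nat \<Rightarrow> 'a fl \<Rightarrow> bool" where
  "fl_order_ge n x \<longleftrightarrow> (\<forall>k<n. fl_part k x = 0)"

lemma fl_order_ge_simps:
  "fl_order_ge n 0"
  "fl_order_ge n x \<Longrightarrow> fl_order_ge n y \<Longrightarrow> fl_order_ge n (x + y)"
  "fl_order_ge n x \<Longrightarrow> fl_order_ge n (fl_scale c x)"
  "fl_order_ge n x \<Longrightarrow> fl_order_ge n (- x)"
  "fl_order_ge n x \<Longrightarrow> fl_order_ge n y \<Longrightarrow> fl_order_ge n (x - y)"
  by (simp_all add: fl_order_ge_def fl_part.zero fl_part_add fl_part_scale fl_part.minus fl_part.diff)

lemma fl_order_ge_sum: "(\<And>i. i \<in> I \<Longrightarrow> fl_order_ge n (F i)) \<Longrightarrow> fl_order_ge n (sum F I)"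
  by (simp add: fl_order_ge_def fl_part.sum)

lemma fl_order_ge_bracket:
  assumes "fl_order_ge n y"
  shows "fl_order_ge (Suc n) (fl_bracket x y)"
  unfolding fl_order_ge_def
proof (intro allI impI)
  fix k assume "k < Suc n"
  then have "fl_bracket (fl_part i x) (fl_part (k - i) y) = 0" if "i \<le> k" for i
    using assms that
    by (cases "i = 0") (auto simp: fl_order_ge_def fl_bracket_left.zero fl_bracket_right.zero)
  then show "fl_part k (fl_bracket x y) = 0"
    by (simp add: fl_part_bracket)
qed

lemma FL_I: "degfin f \<Longrightarrow> (\<And>m. f m \<noteq> 0 \<Longrightarrow> set_monomial m \<subseteq> S) \<Longrightarrow> abs_fl f \<in> FL S"
  by (auto simp: FL_def)

lemma FL_E:
  assumes "x \<in> FL S"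
  obtains f where "degfin f" "\<And>m. f m \<noteq> 0 \<Longrightarrow> set_monomial m \<subseteq> S" "x = abs_fl f"
  using assms by (auto simp: FL_def)

lemma FL_zero: "0 \<in> FL S"
  unfolding zero_fl_def by (rule FL_I) (auto simp: degfin_zero)

lemma FL_add:
  assumes "x \<in> FL S" "y \<in> FL S"
  shows "x + y \<in> FL S"
proof -
  from assms(1) obtain f where f: "degfin f" "\<And>m. f m \<noteq> 0 \<Longrightarrow> set_monomial m \<subseteq> S" "x = abs_fl f"
    by (rule FL_E) blast
  from assms(2) obtain g where g: "degfin g" "\<And>m. g m \<noteq> 0 \<Longrightarrow> set_monomial m \<subseteq> S" "y = abs_fl g"
    by (rule FL_E) blast
  have "abs_fl (\<lambda>m. f m + g m) \<in> FL S"
    using f(1,2) g(1,2) by (intro FL_I degfin_add) (auto, metis add.left_neutral subsetD)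
  then show ?thesis
    using f g by (simp add: plus_fl.abs_eq)
qed

lemma FL_scale:
  assumes "x \<in> FL S"
  shows "fl_scale c x \<in> FL S"
proof -
  from assms obtain f where f: "degfin f" "\<And>m. f m \<noteq> 0 \<Longrightarrow> set_monomial m \<subseteq> S" "x = abs_fl f"
    by (rule FL_E) blast
  then show ?thesis
    using FL_I[of "\<lambda>m. c * f m" S] by (simp add: fl_scale.abs_eq degfin_scale)
qed

lemma FL_uminus: "x \<in> FL S \<Longrightarrow> - x \<in> FL S"
  using FL_scale[of x S "-1"] by simp

lemma FL_sum: "(\<And>i. i \<in> I \<Longrightarrow> F i \<in> FL S) \<Longrightarrow> sum F I \<in> FL S"
  by (induction I rule: infinite_finite_induct) (auto simp: FL_zero FL_add)

lemma FL_bracket: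
  assumes "x \<in> FL S" "y \<in> FL S"
  shows "fl_bracket x y \<in> FL S"
proof -
  from assms(1) obtain f where f: "degfin f" "\<And>m. f m \<noteq> 0 \<Longrightarrow> set_monomial m \<subseteq> S" "x = abs_fl f"
    by (rule FL_E) blast
  from assms(2) obtain g where g: "degfin g" "\<And>m. g m \<noteq> 0 \<Longrightarrow> set_monomial m \<subseteq> S" "y = abs_fl g"
    by (rule FL_E) blast
  have "set_monomial m \<subseteq> S" if "na_mult f g m \<noteq> 0" for m
    using that f(2) g(2) by (cases m) auto
  then show ?thesis
    using f g by (auto simp: fl_bracket.abs_eq intro!: FL_I degfin_mult)
qed

lemma degfin_gen: "degfin (\<lambda>m. if m = Gen a then 1 else 0)"
  by (auto simp: degfin_def)

lemma FL_gen: "a \<in> S \<Longrightarrow> fl_gen a \<in> FL S"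
  unfolding fl_gen_def by (auto intro!: FL_I degfin_gen split: if_splits)

primrec fl_mono :: "'a monomial \<Rightarrow> 'a fl" where
  "fl_mono (Gen a) = fl_gen a"
| "fl_mono (Mul u v) = fl_bracket (fl_mono u) (fl_mono v)"

lemma degfin_mono: "degfin (\<lambda>m'. if m' = m then 1 else 0)"
  unfolding degfin_def by (auto intro: rev_finite_subset[of "{m}"])

lemma fl_mono_eq: "fl_mono m = abs_fl (\<lambda>m'. if m' = m then 1 else 0)"
proof (induction m)
  case (Gen a)
  then show ?case by (simp add: fl_gen_def)
next
  case (Mul u v)
  have "na_mult (\<lambda>m'. if m' = u then 1 else 0) (\<lambda>m'. if m' = v then 1 else 0) m
      = (if m = Mul u v then 1 else 0)" for m
    by (cases m) auto
  then have "na_mult (\<lambda>m'. if m' = u then 1 else 0) (\<lambda>m'. if m' = v then 1 else 0)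
      = (\<lambda>m. if m = Mul u v then 1 else 0)"
    by blast
  then show ?case
    by (simp add: Mul fl_bracket.abs_eq degfin_mono)
qed

lemma FL_trunc_induct [consumes 1, case_names zero add scale gen bracket]:
  assumes "x \<in> FL S"
    and zero: "P 0"
    and add: "\<And>x y. x \<in> FL S \<Longrightarrow> y \<in> FL S \<Longrightarrow> P x \<Longrightarrow> P y \<Longrightarrow> P (x + y)"
    and scale: "\<And>c x. x \<in> FL S \<Longrightarrow> P x \<Longrightarrow> P (fl_scale c x)"
    and gen: "\<And>a. a \<in> S \<Longrightarrow> P (fl_gen a)"
    and bracket: "\<And>x y. x \<in> FL S \<Longrightarrow> y \<in> FL S \<Longrightarrow> P x \<Longrightarrow> P y \<Longrightarrow> P (fl_bracket x y)"
  shows "\<exists>y\<in>FL S. P y \<and> (\<forall>k\<le>n. fl_part k y = fl_part k x)"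
proof -
  from assms(1) obtain f where f: "degfin f" "\<And>m. f m \<noteq> 0 \<Longrightarrow> set_monomial m \<subseteq> S" "x = abs_fl f"
    by (rule FL_E) blast
  define I where "I = {m. deg m \<le> n \<and> f m \<noteq> 0}"
  have I: "finite I" unfolding I_def by (rule finite_deg_le[OF f(1)])
  define y where "y = (\<Sum>m\<in>I. fl_scale (f m) (fl_mono m))"
  have mono: "set_monomial m \<subseteq> S \<Longrightarrow> fl_mono m \<in> FL S \<and> P (fl_mono m)" for m
    by (induction m) (auto simp: gen bracket FL_gen FL_bracket)
  have "sum F J \<in> FL S \<and> P (sum F J)" if "\<And>m. m \<in> J \<Longrightarrow> F m \<in> FL S \<and> P (F m)"
    for J :: "'a monomial set" and F
    using that by (induction J rule: infinite_finite_induct) (auto simp: zero add FL_zero FL_add)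
  moreover have "fl_scale (f m) (fl_mono m) \<in> FL S \<and> P (fl_scale (f m) (fl_mono m))"
    if "m \<in> I" for m
    using that mono[of m] f(2) scale FL_scale by (auto simp: I_def)
  ultimately have y: "y \<in> FL S \<and> P y"
    unfolding y_def by simp
  define g where "g = (\<lambda>m'. \<Sum>m\<in>I. f m * (if m' = m then 1 else 0))"
  have g: "degfin g \<and> abs_fl g = y"
    unfolding y_def g_def
    using abs_fl_sum[OF I, of "\<lambda>m m'. f m * (if m' = m then 1 else 0)",
        OF degfin_scale[OF degfin_mono]]
    by (simp only: fl_mono_eq fl_scale.abs_eq lie_eq_self degfin_mono)
  have "g m = (if m \<in> I then f m else 0)" for m
    using I by (simp add: g_def if_distrib[of "(*) _"] sum.delta' cong: if_cong)
  then have "hom_part k g = hom_part k f" if "k \<le> n" for k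
    using that by (auto simp: hom_part_def I_def)
  then have "fl_part k y = fl_part k x" if "k \<le> n" for k
    using that f g by (metis fl_part.abs_eq lie_eq_self)
  with y show ?thesis by blast
qed

section \<open>Derivations determined by their values on generators\<close>

text \<open>
  \<open>na_der l w f\<close> is the coefficient at \<open>w\<close> of the image of \<open>f\<close> under the derivation
  \<open>a \<mapsto> a \<cdot> l a\<close> of the non-associative algebra. Recursion on the output monomial \<open>w\<close> instead of
  on the monomials of \<open>f\<close> avoids any infinite sum.
\<close>

primrec na_der :: "('a \<Rightarrow> 'a monomial \<Rightarrow> rat) \<Rightarrow> 'a monomial \<Rightarrow> ('a monomial \<Rightarrow> rat) \<Rightarrow> rat" where
  "na_der l (Gen a) f = 0"
| "na_der l (Mul u v) f = (case u of Gen a \<Rightarrow> f u * l a v | Mul _ _ \<Rightarrow> 0)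
     + na_der l u (\<lambda>p. f (Mul p v)) + na_der l v (\<lambda>q. f (Mul u q))"

lemma na_der_add: "na_der l w (\<lambda>m. f m + g m) = na_der l w f + na_der l w g"
  by (induction w arbitrary: f g) (auto simp: algebra_simps split: monomial.split)

lemma na_der_scale: "na_der l w (\<lambda>m. c * f m) = c * na_der l w f"
  by (induction w arbitrary: f) (auto simp: algebra_simps split: monomial.split)

lemma na_der_zero: "na_der l w (\<lambda>m. 0) = 0"
  using na_der_scale[of l w 0] by simp

lemma na_der_sum: "na_der l w (\<lambda>m. \<Sum>i\<in>I. F i m) = (\<Sum>i\<in>I. na_der l w (F i))"
  by (induction I rule: infinite_finite_induct) (simp_all add: na_der_zero na_der_add)

lemma na_der_mult:
  "na_der l w (na_mult f g)
    = na_mult (\<lambda>u. na_der l u f) g w + na_mult f (\<lambda>v. na_der l v g) w"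
proof (cases w)
  case (Mul u v)
  have "na_der l u (\<lambda>p. f p * g v) = na_der l u f * g v"
    using na_der_scale[of l u "g v" f] by (simp add: mult.commute)
  then show ?thesis
    by (simp add: Mul na_der_scale split: monomial.split)
qed simp

lemma na_der_gen:
  "na_der l w (\<lambda>m. if m = Gen a then 1 else 0) = na_mult (\<lambda>m. if m = Gen a then 1 else 0) (l a) w"
  by (cases w) (auto simp: na_der_zero split: monomial.split)

lemma na_der_local: "(\<And>m. deg m < deg w \<Longrightarrow> f m = g m) \<Longrightarrow> na_der l w f = na_der l w g"
proof (induction w arbitrary: f g)
  case (Mul u v)
  have "na_der l u (\<lambda>p. f (Mul p v)) = na_der l u (\<lambda>p. g (Mul p v))"
    by (rule Mul.IH(1)) (simp add: Mul.prems)
  moreover have "na_der l v (\<lambda>q. f (Mul u q)) = na_der l v (\<lambda>q. g (Mul u q))"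
    by (rule Mul.IH(2)) (simp add: Mul.prems)
  moreover have "f u = g u"
    by (rule Mul.prems) (simp add: deg_pos)
  ultimately show ?case
    by (cases u) simp_all
qed simp

lemma na_der_nonzero: "na_der l w f \<noteq> 0 \<Longrightarrow> \<exists>m. deg m < deg w \<and> f m \<noteq> 0"
  using na_der_local[of w f "\<lambda>m. 0" l] na_der_zero[of l w] by auto

lemma na_der_Mul_nonzero:
  assumes "na_der l (Mul u v) f \<noteq> 0"
  obtains a where "u = Gen a" "f u \<noteq> 0" "l a v \<noteq> 0"
    | "na_der l u (\<lambda>p. f (Mul p v)) \<noteq> 0" | "na_der l v (\<lambda>q. f (Mul u q)) \<noteq> 0"
proof -
  have "(case u of Gen a \<Rightarrow> f u * l a v | Mul _ _ \<Rightarrow> 0) \<noteq> 0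
      \<or> na_der l u (\<lambda>p. f (Mul p v)) \<noteq> 0 \<or> na_der l v (\<lambda>q. f (Mul u q)) \<noteq> 0"
    using assms unfolding na_der.simps by linarith
  then show thesis
    using that by (elim disjE) (cases u; simp)+
qed

lemma na_der_support:
  assumes "\<And>a m. l a m \<noteq> 0 \<Longrightarrow> set_monomial m \<subseteq> S"
  shows "(\<And>m. f m \<noteq> 0 \<Longrightarrow> set_monomial m \<subseteq> S) \<Longrightarrow> na_der l w f \<noteq> 0 \<Longrightarrow> set_monomial w \<subseteq> S"
proof (induction w arbitrary: f)
  case (Mul u v)
  from Mul.prems(2) show ?case
  proof (cases rule: na_der_Mul_nonzero)
    case (1 a)
    then show ?thesis using assms[of a v] Mul.prems(1)[of u] by auto
  next
    case 2
    obtain p where "f (Mul p v) \<noteq> 0"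
      using na_der_nonzero[OF 2] by auto
    moreover have "set_monomial u \<subseteq> S"
      using Mul.prems(1) by (intro Mul.IH(1)[OF _ 2]) fastforce
    ultimately show ?thesis using Mul.prems(1)[of "Mul p v"] by auto
  next
    case 3
    obtain q where "f (Mul u q) \<noteq> 0"
      using na_der_nonzero[OF 3] by auto
    moreover have "set_monomial v \<subseteq> S"
      using Mul.prems(1) by (intro Mul.IH(2)[OF _ 3]) fastforce
    ultimately show ?thesis using Mul.prems(1)[of "Mul u q"] by auto
  qed
qed simp

lemma degfin_na_der:
  assumes l: "\<And>a. degfin (l a)" and "degfin f"
  shows "degfin (\<lambda>w. na_der l w f)"
proof -
  have "finite {w. deg w = n \<and> na_der l w f \<noteq> 0}" for n
    using \<open>degfin f\<close>
  proof (induction n arbitrary: f rule: less_induct)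
    case (less n)
    let ?M = "{m. deg m \<le> n \<and> f m \<noteq> 0}"
    have M: "finite ?M" by (rule finite_deg_le[OF less.prems])
    define U where "U = fst ` (\<lambda>m. case m of Gen _ \<Rightarrow> (m, m) | Mul u v \<Rightarrow> (u, v)) ` ?M"
    define V where "V = snd ` (\<lambda>m. case m of Gen _ \<Rightarrow> (m, m) | Mul u v \<Rightarrow> (u, v)) ` ?M"
    have UV: "finite U" "finite V" using M by (simp_all add: U_def V_def)
    have inU: "u \<in> U" and inV: "v \<in> V" if "f (Mul u v) \<noteq> 0" "deg (Mul u v) \<le> n" for u v
      using that unfolding U_def V_def image_image by (auto intro!: image_eqI[of _ _ "Mul u v"])
    have left: "degfin (\<lambda>p. f (Mul p v))" for v
      unfolding degfin_def
    proof
      fix k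
      have "(\<lambda>p. Mul p v) ` {p. deg p = k \<and> f (Mul p v) \<noteq> 0} \<subseteq> {m. deg m = k + deg v \<and> f m \<noteq> 0}"
        by auto
      then have "finite ((\<lambda>p. Mul p v) ` {p. deg p = k \<and> f (Mul p v) \<noteq> 0})"
        using less.prems unfolding degfin_def by (meson finite_subset)
      then show "finite {p. deg p = k \<and> f (Mul p v) \<noteq> 0}"
        by (rule finite_imageD) (auto simp: inj_on_def)
    qed
    have right: "degfin (\<lambda>q. f (Mul u q))" for u
      unfolding degfin_def
    proof
      fix k
      have "Mul u ` {q. deg q = k \<and> f (Mul u q) \<noteq> 0} \<subseteq> {m. deg m = deg u + k \<and> f m \<noteq> 0}"
        by auto
      then have "finite (Mul u ` {q. deg q = k \<and> f (Mul u q) \<noteq> 0})"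
        using less.prems unfolding degfin_def by (meson finite_subset)
      then show "finite {q. deg q = k \<and> f (Mul u q) \<noteq> 0}"
        by (rule finite_imageD) (auto simp: inj_on_def)
    qed
    define W1 where "W1 = (\<Union>m\<in>?M. \<Union>a\<in>set_monomial m. Mul m ` {v. deg v \<le> n \<and> l a v \<noteq> 0})"
    define W2 where "W2 = (\<Union>v\<in>V. \<Union>k\<in>{..<n}. (\<lambda>u. Mul u v) ` {u. deg u = k \<and> na_der l u (\<lambda>p. f (Mul p v)) \<noteq> 0})"
    define W3 where "W3 = (\<Union>u\<in>U. \<Union>k\<in>{..<n}. Mul u ` {v. deg v = k \<and> na_der l v (\<lambda>q. f (Mul u q)) \<noteq> 0})"
    have fin_set: "finite (set_monomial m)" for m :: "'a monomial"
      by (induction m) auto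
    have "finite W1"
      unfolding W1_def using M l fin_set
      by (intro finite_UN_I finite_imageI finite_deg_le[where f = "l _"]) auto
    moreover have "finite W2" "finite W3"
      unfolding W2_def W3_def using UV left right less.IH by auto
    moreover have "{w. deg w = n \<and> na_der l w f \<noteq> 0} \<subseteq> W1 \<union> W2 \<union> W3"
    proof
      fix w assume w: "w \<in> {w. deg w = n \<and> na_der l w f \<noteq> 0}"
      then obtain u v where uv: "w = Mul u v" by (cases w) auto
      have du: "deg u < n" and dv: "deg v < n"
        using w uv deg_pos[of u] deg_pos[of v] by auto
      have "na_der l (Mul u v) f \<noteq> 0" using w uv by blast
      then show "w \<in> W1 \<union> W2 \<union> W3"
      proof (cases rule: na_der_Mul_nonzero)
        case (1 a)
        then have "w \<in> W1"
          unfolding W1_def uv using du dv by (intro UN_I[of u] UN_I[of a]) auto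
        then show ?thesis by blast
      next
        case 2
        obtain p where p: "deg p < deg u" "f (Mul p v) \<noteq> 0"
          using na_der_nonzero[OF 2] by auto
        then have "v \<in> V" using w uv by (intro inV[of p]) auto
        then have "w \<in> W2"
          unfolding W2_def uv using du 2 by (intro UN_I[of v] UN_I[of "deg u"]) auto
        then show ?thesis by blast
      next
        case 3
        obtain q where q: "deg q < deg v" "f (Mul u q) \<noteq> 0"
          using na_der_nonzero[OF 3] by auto
        then have "u \<in> U" using w uv by (intro inU[of _ q]) auto
        then have "w \<in> W3"
          unfolding W3_def uv using dv 3 by (intro UN_I[of u] UN_I[of "deg v"]) auto
        then show ?thesis by blast
      qed
    qed
    ultimately show ?case by (meson finite_UnI finite_subset)
  qed
  then show ?thesis by (simp add: degfin_def)
qed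

lemma na_der_hom_part:
  "hom_part n (\<lambda>w. na_der l w f) = (\<lambda>w. \<Sum>k<n. hom_part n (\<lambda>w. na_der l w (hom_part k f)) w)"
proof
  fix w
  show "hom_part n (\<lambda>w. na_der l w f) w = (\<Sum>k<n. hom_part n (\<lambda>w. na_der l w (hom_part k f)) w)"
  proof (cases "deg w = n")
    case True
    have "na_der l w f = na_der l w (\<lambda>m. \<Sum>k<n. hom_part k f m)"
      by (rule na_der_local) (simp add: hom_part_def True)
    then show ?thesis
      by (simp add: hom_part_def[of n] True na_der_sum)
  qed (simp add: hom_part_def)
qed

lemma finsupp_imp_degfin: "finsupp f \<Longrightarrow> degfin f"
  unfolding finsupp_def degfin_def by (auto intro: rev_finite_subset)

lemma closure_abs_fl: "degfin f \<Longrightarrow> f \<in> lie_ideal_closure \<longleftrightarrow> abs_fl f = 0"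
  by (simp add: zero_fl_def abs_fl_eq_iff degfin_zero lie_eq_def)

lemma na_der_lie_ideal:
  assumes l: "\<And>a. degfin (l a)"
  shows "f \<in> lie_ideal \<Longrightarrow> (\<lambda>w. na_der l w f) \<in> lie_ideal_closure \<and> f \<in> lie_ideal_closure"
proof (induction rule: lie_ideal.induct)
  case zero
  then show ?case by (simp add: na_der_zero closure_zero)
next
  case (add f g)
  then show ?case by (simp add: na_der_add closure_add)
next
  case (scale f c)
  then show ?case by (simp add: na_der_scale closure_scale)
next
  case (mult_left f g)
  have "degfin f" "degfin (\<lambda>w. na_der l w f)"
    using mult_left degfin_na_der[of l, OF l] finsupp_imp_degfin by blast+
  then show ?case
    using mult_left by (simp add: na_der_mult closure_add closure_mult_left)
next
  case (mult_right f g)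
  have "degfin g" "degfin (\<lambda>w. na_der l w g)"
    using mult_right degfin_na_der[of l, OF l] finsupp_imp_degfin by blast+
  then show ?case
    using mult_right by (simp add: na_der_mult closure_add closure_mult_right)
next
  case (alternating f)
  define f' where "f' = (\<lambda>w. na_der l w f)"
  have df: "degfin f" "degfin f'"
    using alternating degfin_na_der[of l, OF l] finsupp_imp_degfin unfolding f'_def by blast+
  have "fl_bracket (abs_fl f') (abs_fl f) + fl_bracket (abs_fl f) (abs_fl f') = 0"
    using fl_bracket_swap[of "abs_fl f"] by simp
  then have "(\<lambda>w. na_mult f' f w + na_mult f f' w) \<in> lie_ideal_closure"
    using df by (simp add: closure_abs_fl degfin_add degfin_mult fl_bracket.abs_eq plus_fl.abs_eq)
  moreover have "na_mult f f \<in> lie_ideal_closure"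
    using df fl_bracket_self[of "abs_fl f"]
    by (simp add: closure_abs_fl degfin_mult fl_bracket.abs_eq)
  ultimately show ?case by (simp add: na_der_mult f'_def)
next
  case (jacobi f g h)
  define f' g' h' where d: "f' = (\<lambda>w. na_der l w f)" "g' = (\<lambda>w. na_der l w g)" "h' = (\<lambda>w. na_der l w h)"
  have df: "degfin f" "degfin f'" "degfin g" "degfin g'" "degfin h" "degfin h'"
    using jacobi degfin_na_der[of l, OF l] finsupp_imp_degfin unfolding d by blast+
  have J: "(\<lambda>m. na_mult f (na_mult g h) m + na_mult g (na_mult h f) m + na_mult h (na_mult f g) m)
      \<in> lie_ideal_closure" if "degfin f" "degfin g" "degfin h" for f g h :: "'a monomial \<Rightarrow> rat"
    using that fl_jacobi[of "abs_fl f" "abs_fl g" "abs_fl h"]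
    by (simp add: closure_abs_fl degfin_add degfin_mult fl_bracket.abs_eq plus_fl.abs_eq)
  have "na_der l w (\<lambda>m. na_mult f (na_mult g h) m + na_mult g (na_mult h f) m + na_mult h (na_mult f g) m)
    = (na_mult f' (na_mult g h) w + na_mult g (na_mult h f') w + na_mult h (na_mult f' g) w)
    + ((na_mult f (na_mult g' h) w + na_mult g' (na_mult h f) w + na_mult h (na_mult f g') w)
    + (na_mult f (na_mult g h') w + na_mult g (na_mult h' f) w + na_mult h' (na_mult f g) w))" for w
    by (simp add: na_der_add na_der_mult na_mult_add_right d)
  then show ?case
    using J df by (simp add: closure_add)
qed

lemma na_der_closure:
  assumes l: "\<And>a. degfin (l a)" and "f \<in> lie_ideal_closure"
  shows "(\<lambda>w. na_der l w f) \<in> lie_ideal_closure"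
  unfolding lie_ideal_closure_def
proof (intro CollectI allI)
  fix n
  have "hom_part n (\<lambda>w. na_der l w (hom_part k f)) \<in> lie_ideal" for k
    using na_der_lie_ideal[of l, OF l, of "hom_part k f"] assms(2) by (simp add: lie_ideal_closure_def)
  then show "hom_part n (\<lambda>w. na_der l w f) \<in> lie_ideal"
    unfolding na_der_hom_part[of n l f] by (intro lie_ideal_sum) auto
qed

definition fl_der :: "('a \<Rightarrow> 'a monomial \<Rightarrow> rat) \<Rightarrow> 'a fl \<Rightarrow> 'a fl" where
  "fl_der l x = abs_fl (\<lambda>w. na_der l w (rep_fl x))"

lemma fl_der_abs:
  assumes l: "\<And>a. degfin (l a)" and f: "degfin f"
  shows "fl_der l (abs_fl f) = abs_fl (\<lambda>w. na_der l w f)"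
proof -
  let ?g = "rep_fl (abs_fl f)"
  have g: "lie_eq ?g f"
    using Quotient_rep_abs[OF Quotient_fl, of f] f by simp
  have "na_der l w (\<lambda>m. ?g m - f m) = na_der l w ?g - na_der l w f" for w
    using na_der_add[of l w ?g "\<lambda>m. - 1 * f m"] by (simp only: na_der_scale) simp
  then have "lie_eq (\<lambda>w. na_der l w ?g) (\<lambda>w. na_der l w f)"
    using na_der_closure[of l "\<lambda>m. ?g m - f m"] g l degfin_na_der[of l]
    by (simp add: lie_eq_def)
  then show ?thesis
    unfolding fl_der_def by (rule abs_fl_eqI)
qed

locale degree_raising_derivation =
  fixes D :: "'a fl \<Rightarrow> 'a fl"
  assumes add: "D (x + y) = D x + D y"
    and scale: "D (fl_scale c x) = fl_scale c (D x)"
    and bracket: "D (fl_bracket x y) = fl_bracket (D x) y + fl_bracket x (D y)"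
    and order: "fl_order_ge n x \<Longrightarrow> fl_order_ge (Suc n) (D x)"
begin

sublocale additive D by unfold_locales (rule add)

end

lemma degree_raising_derivation_fl_der:
  assumes l: "\<And>a. degfin (l a)"
  shows "degree_raising_derivation (fl_der l)"
proof
  fix x y :: "'a fl" and c n
  obtain f g where fg: "degfin f" "x = abs_fl f" "degfin g" "y = abs_fl g"
    by (metis fl_cases)
  note s = fl_der_abs[of l, OF l] degfin_na_der[of l, OF l] fg degfin_add degfin_scale degfin_mult degfin_hom_part
    plus_fl.abs_eq fl_scale.abs_eq fl_bracket.abs_eq fl_part.abs_eq
  show "fl_der l (x + y) = fl_der l x + fl_der l y"
    by (simp add: s na_der_add)
  show "fl_der l (fl_scale c x) = fl_scale c (fl_der l x)"
    by (simp add: s na_der_scale)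
  show "fl_der l (fl_bracket x y) = fl_bracket (fl_der l x) y + fl_bracket x (fl_der l y)"
    by (simp add: s na_der_mult)
  have "fl_part k (fl_der l x) = (\<Sum>i<k. fl_part k (fl_der l (fl_part i x)))" for k
    using abs_fl_sum[of "{..<k}" "\<lambda>i. hom_part k (\<lambda>w. na_der l w (hom_part i f))"]
    by (simp add: s na_der_hom_part[of k l f])
  moreover have "fl_der l 0 = 0"
    by (simp add: zero_fl_def s degfin_zero na_der_zero)
  ultimately show "fl_order_ge n x \<Longrightarrow> fl_order_ge (Suc n) (fl_der l x)"
    by (simp add: fl_order_ge_def fl_part.zero)
qed

lemma fl_der_gen:
  "(\<And>a. degfin (l a)) \<Longrightarrow> fl_der l (fl_gen a) = fl_bracket (fl_gen a) (abs_fl (l a))"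
  by (simp add: fl_gen_def fl_der_abs degfin_gen na_der_gen fl_bracket.abs_eq)

lemma FL_fl_der:
  assumes l: "\<And>a. degfin (l a)" "\<And>a m. l a m \<noteq> 0 \<Longrightarrow> set_monomial m \<subseteq> S" and "x \<in> FL S"
  shows "fl_der l x \<in> FL S"
proof -
  from assms(3) obtain f where f: "degfin f" "\<And>m. f m \<noteq> 0 \<Longrightarrow> set_monomial m \<subseteq> S" "x = abs_fl f"
    by (rule FL_E) blast
  have "set_monomial w \<subseteq> S" if "na_der l w f \<noteq> 0" for w
    using na_der_support[of l S f w] l(2) f(2) that by blast
  then show ?thesis
    using f(1,3) l(1) degfin_na_der[of l, OF l(1) f(1)] by (auto simp: fl_der_abs intro!: FL_I)
qed

lemma fl_order_ge_Suc: "fl_order_ge (Suc n) (x - y) \<longleftrightarrow> (\<forall>k\<le>n. fl_part k x = fl_part k y)"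
  by (auto simp: fl_order_ge_def fl_part.diff less_Suc_eq_le)

lemma fl_derivation_unique:
  assumes D: "fl_derivation S D" and D': "fl_derivation S D'"
    and gen: "\<And>a. a \<in> S \<Longrightarrow> D (fl_gen a) = D' (fl_gen a)"
  shows "D = D'"
proof (rule extensionalityI[of _ "FL S"])
  show "D \<in> extensional (FL S)" "D' \<in> extensional (FL S)"
    using D D' by (auto simp: fl_derivation_def PiE_def)
  fix x assume x: "x \<in> FL S"
  show "D x = D' x"
  proof (rule fl_eqI)
    fix n
    have "fl_continuous S D" "fl_continuous S D'"
      using D D' unfolding fl_derivation_def by blast+
    then obtain d d' where d: "\<forall>x\<in>FL S. \<forall>y\<in>FL S. (\<forall>k\<le>d. fl_part k x = fl_part k y)
        \<longrightarrow> (\<forall>k\<le>n. fl_part k (D x) = fl_part k (D y))"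
      and d': "\<forall>x\<in>FL S. \<forall>y\<in>FL S. (\<forall>k\<le>d'. fl_part k x = fl_part k y)
        \<longrightarrow> (\<forall>k\<le>n. fl_part k (D' x) = fl_part k (D' y))"
      unfolding fl_continuous_def by blast
    have lin: "F 0 = 0" if "fl_derivation S F" for F
    proof -
      have "F (fl_scale 0 0) = fl_scale 0 (F 0)"
        using that FL_zero unfolding fl_derivation_def by blast
      then show ?thesis by simp
    qed
    from x have "\<exists>y\<in>FL S. D y = D' y \<and> (\<forall>k\<le>max d d'. fl_part k y = fl_part k x)"
    proof (induction rule: FL_trunc_induct)
      case zero
      then show ?case using lin D D' by metis
    next
      case (add x y)
      then show ?case using D D' by (simp add: fl_derivation_def)
    next
      case (scale c x)
      then show ?case using D D' by (simp add: fl_derivation_def)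
    next
      case (gen a)
      then show ?case by (rule assms(3))
    next
      case (bracket x y)
      then show ?case using D D' by (simp add: fl_derivation_def)
    qed
    then obtain y where y: "y \<in> FL S" "D y = D' y" "\<forall>k\<le>max d d'. fl_part k y = fl_part k x"
      by blast
    have "fl_part n (D y) = fl_part n (D x)" "fl_part n (D' y) = fl_part n (D' x)"
      using d[rule_format, OF y(1) x] d'[rule_format, OF y(1) x] y(3) by simp_all
    then show "fl_part n (D x) = fl_part n (D' x)" using y(2) by simp
  qed
qed

lemma (in degree_raising_derivation) fl_derivation_restrict:
  assumes "\<And>x. x \<in> FL S \<Longrightarrow> D x \<in> FL S"
  shows "fl_derivation S (restrict D (FL S))"
  unfolding fl_derivation_def fl_continuous_def
proof (intro conjI allI ballI)
  show "restrict D (FL S) \<in> FL S \<rightarrow>\<^sub>E FL S" using assms by simp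
  show "\<exists>d. \<forall>x\<in>FL S. \<forall>y\<in>FL S. (\<forall>k\<le>d. fl_part k x = fl_part k y)
      \<longrightarrow> (\<forall>k\<le>n. fl_part k (restrict D (FL S) x) = fl_part k (restrict D (FL S) y))" for n
  proof (intro exI[of _ n] ballI impI)
    fix x y assume xy: "x \<in> FL S" "y \<in> FL S" "\<forall>k\<le>n. fl_part k x = fl_part k y"
    then have "fl_order_ge (Suc (Suc n)) (D x - D y)"
      using order[of "Suc n" "x - y"] by (simp add: fl_order_ge_Suc diff)
    then show "\<forall>k\<le>n. fl_part k (restrict D (FL S) x) = fl_part k (restrict D (FL S) y)"
      using xy by (simp add: fl_order_ge_Suc)
  qed
qed (simp_all add: add scale bracket FL_add FL_scale FL_bracket)

lemma tder_exists:
  assumes "lam \<in> S \<rightarrow> FL S"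
  obtains D where "degree_raising_derivation D" "\<And>x. x \<in> FL S \<Longrightarrow> D x \<in> FL S"
    "\<And>a. a \<in> S \<Longrightarrow> D (fl_gen a) = fl_bracket (fl_gen a) (lam a)"
    "tder S lam = restrict D (FL S)"
proof -
  have "\<exists>f. degfin f \<and> (\<forall>m. f m \<noteq> 0 \<longrightarrow> set_monomial m \<subseteq> S) \<and> (a \<in> S \<longrightarrow> abs_fl f = lam a)" for a
  proof (cases "a \<in> S")
    case True
    with assms have "lam a \<in> FL S" by blast
    then show ?thesis by (rule FL_E) metis
  next
    case False
    then show ?thesis by (intro exI[of _ "\<lambda>m. 0"]) (simp add: degfin_zero)
  qed
  then obtain l where l: "\<And>a. degfin (l a)" "\<And>a m. l a m \<noteq> 0 \<Longrightarrow> set_monomial m \<subseteq> S"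
      "\<And>a. a \<in> S \<Longrightarrow> abs_fl (l a) = lam a"
    by metis
  interpret degree_raising_derivation "fl_der l"
    by (rule degree_raising_derivation_fl_der[of l, OF l(1)])
  have FL: "fl_der l x \<in> FL S" if "x \<in> FL S" for x
    using FL_fl_der[of l S x] l that by blast
  have gen: "fl_der l (fl_gen a) = fl_bracket (fl_gen a) (lam a)" if "a \<in> S" for a
    using that by (simp add: fl_der_gen l)
  have "tder S lam = restrict (fl_der l) (FL S)"
    unfolding tder_def
  proof (rule the_equality)
    show "fl_derivation S (restrict (fl_der l) (FL S))
        \<and> (\<forall>a\<in>S. restrict (fl_der l) (FL S) (fl_gen a) = fl_bracket (fl_gen a) (lam a))"
      using fl_derivation_restrict[of S, OF FL] gen FL_gen[of _ S] by simp
    then show "D = restrict (fl_der l) (FL S)" if "fl_derivation S D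
        \<and> (\<forall>a\<in>S. D (fl_gen a) = fl_bracket (fl_gen a) (lam a))" for D
      using that by (intro fl_derivation_unique) auto
  qed
  then show thesis
    using that[OF _ FL gen] degree_raising_derivation_axioms by blast
qed

section \<open>Power series in t\<close>

lemma fps_nth_flt_scale: "fps_nth (flt_scale c x) n = (\<Sum>i\<le>n. fl_scale (fps_nth c i) (fps_nth x (n - i)))"
  by (simp add: flt_scale_def)

lemma fps_nth_flt_bracket:
  "fps_nth (flt_bracket x y) n = (\<Sum>i\<le>n. fl_bracket (fps_nth x i) (fps_nth y (n - i)))"
  by (simp add: flt_bracket_def)

lemma fps_nth_flt_map [simp]: "fps_nth (flt_map F x) n = F (fps_nth x n)"
  by (simp add: flt_map_def)

lemma fps_nth_ddt: "fps_nth (ddt x) n = fl_scale (of_nat (Suc n)) (fps_nth x (Suc n))"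
  by (simp add: ddt_def)

lemma fps_nth_flt_scale_const [simp]:
  "fps_nth (flt_scale (fps_const c) x) n = fl_scale c (fps_nth x n)"
proof -
  have "(\<Sum>i\<le>n. fl_scale (if i = 0 then c else 0) (fps_nth x (n - i)))
      = (\<Sum>i\<le>n. if i = 0 then fl_scale c (fps_nth x n) else 0)"
    by (rule sum.cong) auto
  then show ?thesis by (simp add: fps_nth_flt_scale)
qed

lemma flt_scale_one [simp]: "flt_scale 1 x = x"
  using fps_nth_flt_scale_const[of 1 x] by (simp add: fps_eq_iff)

lemma flt_scale_uminus: "flt_scale (- c) x = - flt_scale c x"
  by (simp add: fps_eq_iff fps_nth_flt_scale sum_negf)

lemma fps_nth_flt_scale_X:
  "fps_nth (flt_scale fps_X x) n = (if n = 0 then 0 else fps_nth x (n - 1))"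
proof -
  have "fps_nth (flt_scale fps_X x) n = (\<Sum>i\<le>n. if i = 1 then fps_nth x (n - 1) else 0)"
    unfolding fps_nth_flt_scale by (rule sum.cong) (auto simp: fps_X_def)
  then show ?thesis by simp
qed

lemma flt_bracket_add_left: "flt_bracket (x + y) z = flt_bracket x z + flt_bracket y z"
  by (simp add: fps_eq_iff fps_nth_flt_bracket fl_bracket_add_left sum.distrib)

lemma flt_bracket_add_right: "flt_bracket z (x + y) = flt_bracket z x + flt_bracket z y"
  by (simp add: fps_eq_iff fps_nth_flt_bracket fl_bracket_add_right sum.distrib)

interpretation flt_bracket_left: additive "\<lambda>x. flt_bracket x z" for z
  by unfold_locales (rule flt_bracket_add_left)

interpretation flt_bracket_right: additive "flt_bracket z" for z
  by unfold_locales (rule flt_bracket_add_right)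

interpretation flt: vector_space "\<lambda>c. flt_scale (fps_const c)"
  by unfold_locales
    (simp_all add: fps_eq_iff fl.scale_right_distrib fl.scale_left_distrib)

lemma flt_bracket_scale_left:
  "flt_bracket (flt_scale (fps_const c) x) y = flt_scale (fps_const c) (flt_bracket x y)"
  by (simp add: fps_eq_iff fps_nth_flt_bracket fl_bracket_scale_left fl.scale_sum_right)

lemma flt_bracket_scale_right:
  "flt_bracket x (flt_scale (fps_const c) y) = flt_scale (fps_const c) (flt_bracket x y)"
  by (simp add: fps_eq_iff fps_nth_flt_bracket fl_bracket_scale_right fl.scale_sum_right)

lemma flt_bracket_swap: "flt_bracket x y = - flt_bracket y x"
proof -
  have "(\<Sum>i\<le>n. fl_bracket (fps_nth x i) (fps_nth y (n - i)))
      = (\<Sum>i\<le>n. fl_bracket (fps_nth x (n - i)) (fps_nth y i))" for n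
    by (rule sum.reindex_bij_witness[of _ "\<lambda>i. n - i" "\<lambda>i. n - i"]) auto
  also have "\<dots> n = (\<Sum>i\<le>n. - fl_bracket (fps_nth y i) (fps_nth x (n - i)))" for n
    by (rule sum.cong[OF refl]) (rule fl_bracket_swap)
  finally show ?thesis
    by (simp add: fps_eq_iff fps_nth_flt_bracket sum_negf)
qed

lemma sum_triangle_assoc:
  fixes f :: "nat \<Rightarrow> nat \<Rightarrow> nat \<Rightarrow> 'b::comm_monoid_add"
  shows "(\<Sum>j\<le>n. \<Sum>i\<le>j. f i (j - i) (n - j)) = (\<Sum>i\<le>n. \<Sum>j\<le>n - i. f i j (n - i - j))"
  using fps_mult_assoc_lemma[of f n n] by (simp add: atLeast0AtMost)

lemma sum_triangle_swap:
  fixes f :: "nat \<Rightarrow> nat \<Rightarrow> nat \<Rightarrow> 'b::comm_monoid_add"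
  shows "(\<Sum>j\<le>n. \<Sum>i\<le>n - j. f i j (n - j - i)) = (\<Sum>i\<le>n. \<Sum>j\<le>n - i. f i j (n - i - j))"
proof -
  have "(\<Sum>i\<le>m. f (m - i) i (n - m)) = (\<Sum>i\<le>m. f i (m - i) (n - m))" for m
    by (rule sum.reindex_bij_witness[of _ "\<lambda>i. m - i" "\<lambda>i. m - i"]) auto
  then show ?thesis
    using sum_triangle_assoc[of f n] sum_triangle_assoc[of "\<lambda>j i. f i j" n] by simp
qed

lemma flt_bracket_derivation:
  "flt_bracket x (flt_bracket y z) = flt_bracket (flt_bracket x y) z + flt_bracket y (flt_bracket x z)"
proof (rule fps_ext)
  fix n
  let ?b = fl_bracket and ?x = "fps_nth x" and ?y = "fps_nth y" and ?z = "fps_nth z"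
  have "fps_nth (flt_bracket x (flt_bracket y z)) n
      = (\<Sum>i\<le>n. \<Sum>j\<le>n - i. ?b (?x i) (?b (?y j) (?z (n - i - j))))"
    by (simp add: fps_nth_flt_bracket fl_bracket_right.sum)
  also have "\<dots> = (\<Sum>i\<le>n. \<Sum>j\<le>n - i. ?b (?b (?x i) (?y j)) (?z (n - i - j)))
      + (\<Sum>i\<le>n. \<Sum>j\<le>n - i. ?b (?y j) (?b (?x i) (?z (n - i - j))))"
    by (simp only: fl_bracket_derivation[of "?x _" "?y _"] sum.distrib)
  also have "(\<Sum>i\<le>n. \<Sum>j\<le>n - i. ?b (?b (?x i) (?y j)) (?z (n - i - j)))
      = fps_nth (flt_bracket (flt_bracket x y) z) n"
    by (simp only: fps_nth_flt_bracket fl_bracket_left.sum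
        sum_triangle_assoc[of "\<lambda>i j k. ?b (?b (?x i) (?y j)) (?z k)", symmetric])
  also have "(\<Sum>i\<le>n. \<Sum>j\<le>n - i. ?b (?y j) (?b (?x i) (?z (n - i - j))))
      = fps_nth (flt_bracket y (flt_bracket x z)) n"
    by (simp only: fps_nth_flt_bracket fl_bracket_right.sum
        sum_triangle_swap[of "\<lambda>i j k. ?b (?y j) (?b (?x i) (?z k))", symmetric])
  finally show "fps_nth (flt_bracket x (flt_bracket y z)) n
      = fps_nth (flt_bracket (flt_bracket x y) z + flt_bracket y (flt_bracket x z)) n"
    by simp
qed

lemma (in vector_space) scale_sum_leibniz:
  "scale (of_nat (Suc n)) (\<Sum>i\<le>Suc n. h i (Suc n - i))
    = (\<Sum>i\<le>n. scale (of_nat (Suc i)) (h (Suc i) (n - i)))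
      + (\<Sum>i\<le>n. scale (of_nat (Suc (n - i))) (h i (Suc (n - i))))"
proof -
  have "scale (of_nat (Suc n)) (\<Sum>i\<le>Suc n. h i (Suc n - i))
      = (\<Sum>i\<le>Suc n. scale (of_nat i) (h i (Suc n - i)) + scale (of_nat (Suc n - i)) (h i (Suc n - i)))"
    unfolding scale_sum_right
    by (intro sum.cong refl)
      (simp add: scale_left_distrib[symmetric] of_nat_add[symmetric] del: of_nat_add)
  also have "\<dots> = (\<Sum>i\<le>Suc n. scale (of_nat i) (h i (Suc n - i)))
      + (\<Sum>i\<le>Suc n. scale (of_nat (Suc n - i)) (h i (Suc n - i)))"
    by (rule sum.distrib)
  also have "(\<Sum>i\<le>Suc n. scale (of_nat i) (h i (Suc n - i)))
      = (\<Sum>i\<le>n. scale (of_nat (Suc i)) (h (Suc i) (n - i)))"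
    by (subst sum.atMost_Suc_shift) simp
  also have "(\<Sum>i\<le>Suc n. scale (of_nat (Suc n - i)) (h i (Suc n - i)))
      = (\<Sum>i\<le>n. scale (of_nat (Suc (n - i))) (h i (Suc (n - i))))"
    by (subst sum.atMost_Suc) (auto simp: Suc_diff_le intro!: sum.cong)
  finally show ?thesis .
qed

lemma ddt_add: "ddt (x + y) = ddt x + ddt y"
  by (simp add: fps_eq_iff fps_nth_ddt fl.scale_right_distrib)

interpretation ddt: additive ddt
  by unfold_locales (rule ddt_add)

lemma ddt_scale_const: "ddt (flt_scale (fps_const c) x) = flt_scale (fps_const c) (ddt x)"
  by (simp add: fps_eq_iff fps_nth_ddt mult.commute)

lemma ddt_const [simp]: "ddt (fps_const x) = 0"
  by (simp add: fps_eq_iff fps_nth_ddt)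

lemma ddt_bracket: "ddt (flt_bracket x y) = flt_bracket (ddt x) y + flt_bracket x (ddt y)"
proof (rule fps_ext)
  show "fps_nth (ddt (flt_bracket x y)) n
      = fps_nth (flt_bracket (ddt x) y + flt_bracket x (ddt y)) n" for n
    using fl.scale_sum_leibniz[of n "\<lambda>i j. fl_bracket (fps_nth x i) (fps_nth y j)"]
    by (simp add: fps_nth_ddt fps_nth_flt_bracket fl_bracket_scale_left fl_bracket_scale_right
        del: of_nat_Suc)
qed

lemma ddt_scale: "ddt (flt_scale c x) = flt_scale (fps_deriv c) x + flt_scale c (ddt x)"
proof (rule fps_ext)
  show "fps_nth (ddt (flt_scale c x)) n
      = fps_nth (flt_scale (fps_deriv c) x + flt_scale c (ddt x)) n" for n
    using fl.scale_sum_leibniz[of n "\<lambda>i j. fl_scale (fps_nth c i) (fps_nth x j)"]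
    by (simp add: fps_nth_ddt fps_nth_flt_scale mult.commute del: of_nat_Suc)
qed

lemma fps_nth_Suc_eqI:
  assumes "fps_nth (ddt x) n = fps_nth (ddt y) n"
  shows "fps_nth x (Suc n) = fps_nth y (Suc n)"
  using assms unfolding fps_nth_ddt by (rule fl.scale_left_imp_eq[rotated]) simp

lemma FLt_nth: "x \<in> FLt S \<Longrightarrow> fps_nth x n \<in> FL S"
  by (simp add: FLt_def)

lemma FLt_add: "x \<in> FLt S \<Longrightarrow> y \<in> FLt S \<Longrightarrow> x + y \<in> FLt S"
  by (simp add: FLt_def FL_add)

lemma FLt_scale: "x \<in> FLt S \<Longrightarrow> flt_scale c x \<in> FLt S"
  by (simp add: FLt_def fps_nth_flt_scale FL_sum FL_scale)

lemma FLt_bracket: "x \<in> FLt S \<Longrightarrow> y \<in> FLt S \<Longrightarrow> flt_bracket x y \<in> FLt S"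
  by (simp add: FLt_def fps_nth_flt_bracket FL_sum FL_bracket)

lemma FLt_const: "x \<in> FL S \<Longrightarrow> fps_const x \<in> FLt S"
  by (simp add: FLt_def FL_zero)

section \<open>Operator series\<close>

definition op_sum :: "rat fps \<Rightarrow> ('a fl fps \<Rightarrow> 'a fl fps) \<Rightarrow> 'a fl fps \<Rightarrow> 'a fl fps" where
  "op_sum p T x = Abs_fps (\<lambda>n. \<Sum>k\<le>n. fl_scale (fps_nth p k) (fps_nth ((T ^^ k) x) n))"

lemma flt_eqI:
  assumes "\<And>n. flt_part n x = flt_part n y"
  shows "x = y"
proof (rule fps_ext, rule fl_eqI)
  show "fl_part m (fps_nth x n) = fl_part m (fps_nth y n)" for m n
    using fun_cong[OF arg_cong[OF assms[of m], of fps_nth], of n] by simp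
qed

lemma op_series_eqI:
  assumes "flt_sums (\<lambda>k. flt_scale (fps_const (fps_nth p k)) ((T ^^ k) x)) y"
  shows "op_series p T x = y"
  unfolding op_series_def
proof (rule the_equality)
  fix z assume z: "flt_sums (\<lambda>k. flt_scale (fps_const (fps_nth p k)) ((T ^^ k) x)) z"
  show "z = y"
  proof (rule flt_eqI)
    fix n
    have "\<forall>\<^sub>F N in sequentially. flt_part n z = flt_part n y"
      using z[unfolded flt_sums_def, rule_format, of n] assms[unfolded flt_sums_def, rule_format, of n]
      by eventually_elim simp
    then show "flt_part n z = flt_part n y" by simp
  qed
qed (rule assms)

lemma op_series_eq_op_sum:
  assumes t: "\<And>k n. n < k \<Longrightarrow> fps_nth ((T ^^ k) x) n = 0"
    and d: "\<And>k n. fl_order_ge k (fps_nth ((T ^^ k) x) n)"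
  shows "op_series p T x = op_sum p T x"
proof (rule op_series_eqI)
  let ?s = "\<lambda>k n. fl_scale (fps_nth p k) (fps_nth ((T ^^ k) x) n)"
  have "flt_part n (\<Sum>k<N. flt_scale (fps_const (fps_nth p k)) ((T ^^ k) x)) = flt_part n (op_sum p T x)"
    if "n < N" for n N
  proof (rule fps_ext)
    fix m
    have "(\<Sum>k<N. fl_part n (?s k m)) = (\<Sum>k\<in>{..m} \<inter> {..<N}. fl_part n (?s k m))"
      by (rule sum.mono_neutral_right)
        (auto, metis fl.scale_zero_right fl_part.zero linorder_not_le t)
    also have "\<dots> = (\<Sum>k\<le>m. fl_part n (?s k m))"
    proof (rule sum.mono_neutral_left)
      show "\<forall>k\<in>{..m} - {..m} \<inter> {..<N}. fl_part n (?s k m) = 0"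
        using d that by (force simp: fl_order_ge_def fl_part_scale)
    qed auto
    finally show "fps_nth (flt_part n (\<Sum>k<N. flt_scale (fps_const (fps_nth p k)) ((T ^^ k) x))) m
        = fps_nth (flt_part n (op_sum p T x)) m"
      by (simp add: op_sum_def fps_sum_nth fl_part.sum)
  qed
  then show "flt_sums (\<lambda>k. flt_scale (fps_const (fps_nth p k)) ((T ^^ k) x)) (op_sum p T x)"
    unfolding flt_sums_def by (intro allI eventually_mono[OF eventually_gt_at_top])
qed

lemma sum_square_triangle:
  fixes f :: "nat \<Rightarrow> nat \<Rightarrow> 'b::comm_monoid_add"
  assumes "\<And>i j. n < i + j \<Longrightarrow> f i j = 0"
  shows "(\<Sum>i\<le>n. \<Sum>j\<le>n. f i j) = (\<Sum>k\<le>n. \<Sum>i\<le>k. f i (k - i))"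
proof -
  have "(\<Sum>i\<le>n. \<Sum>j\<le>n. f i j) = (\<Sum>(i, j)\<in>{..n} \<times> {..n}. f i j)"
    by (rule sum.cartesian_product)
  also have "\<dots> = (\<Sum>(i, j)\<in>{(i, j). i + j \<le> n}. f i j)"
    by (intro sum.mono_neutral_right) (auto, metis assms linorder_not_le)
  also have "\<dots> = (\<Sum>k\<le>n. \<Sum>i\<le>k. f i (k - i))"
    by (rule sum.triangle_reindex_eq)
  finally show ?thesis .
qed

locale raising_op =
  fixes T :: "'a fl fps \<Rightarrow> 'a fl fps"
  assumes add: "T (x + y) = T x + T y"
    and scale: "T (flt_scale (fps_const c) x) = flt_scale (fps_const c) (T x)"
    and t_order: "\<forall>i<n. fps_nth x i = 0 \<Longrightarrow> \<forall>i<Suc n. fps_nth (T x) i = 0"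
    and order: "\<forall>i. fl_order_ge n (fps_nth x i) \<Longrightarrow> \<forall>i. fl_order_ge (Suc n) (fps_nth (T x) i)"
begin

sublocale additive T by unfold_locales (rule add)

lemma pow_additive: "additive (T ^^ k)"
proof
  show "(T ^^ k) (x + y) = (T ^^ k) x + (T ^^ k) y" for x y
    by (induction k) (simp_all add: add)
qed

lemma pow_scale: "(T ^^ k) (flt_scale (fps_const c) x) = flt_scale (fps_const c) ((T ^^ k) x)"
  by (induction k) (simp_all add: scale)

lemma pow_t_order: "\<forall>i<n. fps_nth x i = 0 \<Longrightarrow> \<forall>i<n + k. fps_nth ((T ^^ k) x) i = 0"
  by (induction k) (use t_order in auto)

lemma pow_t_order_0: "i < k \<Longrightarrow> fps_nth ((T ^^ k) x) i = 0"
  using pow_t_order[of 0 x k] by simp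

lemma op_series_eq: "op_series p T x = op_sum p T x"
proof (rule op_series_eq_op_sum)
  have "\<forall>n. fl_order_ge k (fps_nth ((T ^^ k) x) n)" for k
  proof (induction k)
    case (Suc k)
    show ?case using order[OF Suc] by simp
  qed (simp add: fl_order_ge_def)
  then show "fl_order_ge k (fps_nth ((T ^^ k) x) n)" for k n by blast
qed (rule pow_t_order_0)

lemma op_sum_nth:
  assumes "n \<le> N"
  shows "fps_nth (op_sum p T x) n = (\<Sum>k\<le>N. fl_scale (fps_nth p k) (fps_nth ((T ^^ k) x) n))"
  unfolding op_sum_def fps_nth_Abs_fps
proof (rule sum.mono_neutral_left)
  show "\<forall>k\<in>{..N} - {..n}. fl_scale (fps_nth p k) (fps_nth ((T ^^ k) x) n) = 0"
    by (simp add: pow_t_order_0)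
qed (use assms in auto)

lemma op_sum_comp: "op_sum p T (op_sum q T x) = op_sum (p * q) T x"
proof (rule fps_ext)
  fix n
  let ?f = "\<lambda>i j. fl_scale (fps_nth p i * fps_nth q j) (fps_nth ((T ^^ (i + j)) x) n)"
  define z where "z = (\<Sum>j\<le>n. flt_scale (fps_const (fps_nth q j)) ((T ^^ j) x))"
  have pow: "fps_nth ((T ^^ k) (op_sum q T x)) n
      = (\<Sum>j\<le>n. fl_scale (fps_nth q j) (fps_nth ((T ^^ (k + j)) x) n))" for k
  proof -
    interpret k: additive "T ^^ k" by (rule pow_additive)
    have "\<forall>i<Suc n. fps_nth (op_sum q T x - z) i = 0"
      by (auto simp: z_def fps_sum_nth op_sum_nth[of _ n])
    then have "fps_nth ((T ^^ k) (op_sum q T x - z)) n = 0"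
      using pow_t_order[of "Suc n"] by fastforce
    then have "fps_nth ((T ^^ k) (op_sum q T x)) n = fps_nth ((T ^^ k) z) n"
      by (simp add: k.diff)
    then show ?thesis
      by (simp add: z_def k.sum pow_scale fps_sum_nth funpow_add)
  qed
  have "fps_nth (op_sum p T (op_sum q T x)) n = (\<Sum>i\<le>n. \<Sum>j\<le>n. ?f i j)"
    by (simp add: op_sum_nth[of n n p] pow fl.scale_sum_right)
  also have "\<dots> = (\<Sum>k\<le>n. \<Sum>i\<le>k. ?f i (k - i))"
    by (rule sum_square_triangle) (simp add: pow_t_order_0)
  also have "\<dots> = fps_nth (op_sum (p * q) T x) n"
    by (simp add: op_sum_nth[of n n] fps_mult_nth atLeast0AtMost fl.scale_sum_left)
  finally show "fps_nth (op_sum p T (op_sum q T x)) n = fps_nth (op_sum (p * q) T x) n" .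
qed

lemma op_sum_1: "op_sum 1 T x = x"
proof (rule fps_ext)
  fix n
  have "fps_nth (op_sum 1 T x) n = (\<Sum>k\<le>n. if k = 0 then fps_nth x n else 0)"
    unfolding op_sum_nth[of n n, OF order_refl] by (rule sum.cong) auto
  then show "fps_nth (op_sum 1 T x) n = fps_nth x n" by simp
qed

end

lemma raising_op_bracket:
  assumes "fps_nth g 0 = 0"
  shows "raising_op (flt_bracket g)"
proof
  fix x :: "'a fl fps" and n
  show "\<forall>i<Suc n. fps_nth (flt_bracket g x) i = 0" if "\<forall>i<n. fps_nth x i = 0"
  proof (intro allI impI)
    fix i assume i: "i < Suc n"
    have "fl_bracket (fps_nth g j) (fps_nth x (i - j)) = 0" if "j \<le> i" for j
    proof (cases "j = 0")
      case False
      then have "i - j < n" using i that by linarith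
      then show ?thesis using \<open>\<forall>i<n. fps_nth x i = 0\<close> by (simp add: fl_bracket_right.zero)
    qed (simp add: assms fl_bracket_left.zero)
    then show "fps_nth (flt_bracket g x) i = 0" by (simp add: fps_nth_flt_bracket)
  qed
  show "\<forall>i. fl_order_ge (Suc n) (fps_nth (flt_bracket g x) i)" if "\<forall>i. fl_order_ge n (fps_nth x i)"
    using that by (auto simp: fps_nth_flt_bracket intro!: fl_order_ge_sum fl_order_ge_bracket)
qed (simp_all add: flt_bracket_add_right flt_bracket_scale_right)

text \<open>
  In the proof, \<open>W k\<close> and \<open>Y k\<close> are the coefficients of \<open>s\<^sup>k\<close> in \<open>W(s) = exp (s ad g) x\<close> and in the
  solution of \<open>dY/ds = dg/dt + [g, Y]\<close>, \<open>Y(0) = 0\<close>. Both \<open>dW/dt\<close> and \<open>[Y, W]\<close> solve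
  \<open>dZ/ds = [dg/dt, W] + [g, Z]\<close> with \<open>Z(0) = 0\<close>, so they agree; then put \<open>s = 1\<close>.
\<close>

lemma ddt_exp_ad:
  fixes g :: "'a fl fps"
  assumes g: "fps_nth g 0 = 0"
  shows "ddt (op_sum (fps_exp 1) (flt_bracket g) (fps_const x))
    = flt_bracket (op_sum (Abs_fps (\<lambda>k. 1 / fact (Suc k))) (flt_bracket g) (ddt g))
        (op_sum (fps_exp 1) (flt_bracket g) (fps_const x))"
proof -
  interpret raising_op "flt_bracket g" by (rule raising_op_bracket[OF g])
  let ?A = "flt_bracket g"
  let ?sc = "\<lambda>c. flt_scale (fps_const c)"
  define W where "W k = ?sc (1 / fact k) ((?A ^^ k) (fps_const x))" for k
  define Y where "Y k = (case k of 0 \<Rightarrow> 0 | Suc j \<Rightarrow> ?sc (1 / fact (Suc j)) ((?A ^^ j) (ddt g)))" for k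
  have fact_Suc_div: "of_nat (Suc k) * (1 / fact (Suc k)) = (1 / fact k :: rat)" for k
    by (simp add: field_simps del: of_nat_Suc)
  have W_Suc: "?sc (of_nat (Suc k)) (W (Suc k)) = ?A (W k)" for k
    unfolding W_def flt.scale_scale fact_Suc_div by (simp add: scale)
  have Y_Suc: "?sc (of_nat (Suc k)) (Y (Suc k)) = ?A (Y k) + (if k = 0 then ddt g else 0)" for k
  proof (cases k)
    case (Suc j)
    show ?thesis
      unfolding Y_def Suc nat.case flt.scale_scale fact_Suc_div by (simp add: scale)
  qed (simp add: Y_def flt_bracket_right.zero)
  have ddt_W: "ddt (W k) = (\<Sum>i\<le>k. flt_bracket (Y i) (W (k - i)))" for k
  proof (induction k)
    case 0
    then show ?case by (simp add: W_def Y_def flt_bracket_left.zero)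
  next
    case (Suc k)
    have "?sc (of_nat (Suc k)) (ddt (W (Suc k))) = ddt (?A (W k))"
      by (simp only: ddt_scale_const[symmetric] W_Suc)
    also have "\<dots> = flt_bracket (ddt g) (W k) + ?A (\<Sum>i\<le>k. flt_bracket (Y i) (W (k - i)))"
      by (simp add: ddt_bracket Suc)
    also have "?A (\<Sum>i\<le>k. flt_bracket (Y i) (W (k - i)))
        = (\<Sum>i\<le>k. flt_bracket (?A (Y i)) (W (k - i))) + (\<Sum>i\<le>k. flt_bracket (Y i) (?A (W (k - i))))"
      by (simp add: flt_bracket_right.sum flt_bracket_derivation[of g "Y _"] sum.distrib)
    also have "flt_bracket (ddt g) (W k)
        = (\<Sum>i\<le>k. flt_bracket (if i = 0 then ddt g else 0) (W (k - i)))"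
    proof -
      have "(\<Sum>i\<le>k. flt_bracket (if i = 0 then ddt g else 0) (W (k - i)))
          = (\<Sum>i\<le>k. if i = 0 then flt_bracket (ddt g) (W k) else 0)"
        by (rule sum.cong) (auto simp: flt_bracket_left.zero)
      then show ?thesis by simp
    qed
    also have "\<dots> + ((\<Sum>i\<le>k. flt_bracket (?A (Y i)) (W (k - i)))
          + (\<Sum>i\<le>k. flt_bracket (Y i) (?A (W (k - i)))))
        = (\<Sum>i\<le>k. flt_bracket (?sc (of_nat (Suc i)) (Y (Suc i))) (W (k - i)))
          + (\<Sum>i\<le>k. flt_bracket (Y i) (?sc (of_nat (Suc (k - i))) (W (Suc (k - i)))))"
      unfolding W_Suc Y_Suc flt_bracket_add_left sum.distrib by (simp add: ac_simps)
    also have "\<dots> = ?sc (of_nat (Suc k)) (\<Sum>i\<le>Suc k. flt_bracket (Y i) (W (Suc k - i)))"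
      unfolding flt_bracket_scale_left flt_bracket_scale_right
      by (rule flt.scale_sum_leibniz[symmetric])
    finally show ?case
      by (rule flt.scale_left_imp_eq[rotated]) simp
  qed
  let ?phi = "Abs_fps (\<lambda>k. 1 / fact (Suc k)) :: rat fps"
  let ?W = "op_sum (fps_exp 1) ?A (fps_const x)" and ?Y = "op_sum ?phi ?A (ddt g)"
  have W_nth: "fps_nth ?W m = (\<Sum>k\<le>N. fps_nth (W k) m)" if "m \<le> N" for m N
    using that by (simp add: op_sum_nth[of m N] W_def)
  have Y_nth: "fps_nth ?Y m = (\<Sum>k\<le>Suc N. fps_nth (Y k) m)" if "m \<le> N" for m N
  proof -
    have "(\<Sum>k\<le>Suc N. fps_nth (Y k) m) = (\<Sum>k\<le>N. fps_nth (Y (Suc k)) m)"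
      by (subst sum.atMost_Suc_shift) (simp add: Y_def)
    then show ?thesis
      using that by (simp add: op_sum_nth[of m N] Y_def del: fact_Suc)
  qed
  have W0: "fps_nth (W k) m = 0" if "m < k" for k m
    using that by (simp add: W_def pow_t_order_0)
  have Y0: "fps_nth (Y k) m = 0" if "Suc m < k" for k m
    using that by (cases k) (simp_all add: Y_def pow_t_order_0)
  show ?thesis
  proof (rule fps_ext)
    fix n
    have vanish: "fps_nth (flt_bracket (Y i) (W j)) n = 0" if "Suc n < i + j" for i j
    proof -
      have "fl_bracket (fps_nth (Y i) m) (fps_nth (W j) (n - m)) = 0" if "m \<le> n" for m
      proof (cases "Suc m < i")
        case False
        then have "n - m < j" using \<open>Suc n < i + j\<close> that by linarith
        then show ?thesis by (simp add: W0 fl_bracket_right.zero)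
      qed (simp add: Y0 fl_bracket_left.zero)
      then show ?thesis by (simp add: fps_nth_flt_bracket)
    qed
    have "fps_nth (ddt ?W) n = (\<Sum>k\<le>Suc n. fps_nth (ddt (W k)) n)"
      unfolding fps_nth_ddt by (simp only: W_nth[of _ "Suc n"] fl.scale_sum_right)
    also have "\<dots> = (\<Sum>k\<le>Suc n. \<Sum>i\<le>k. fps_nth (flt_bracket (Y i) (W (k - i))) n)"
      by (simp only: ddt_W fps_sum_nth)
    also have "\<dots> = (\<Sum>i\<le>Suc n. \<Sum>j\<le>Suc n. fps_nth (flt_bracket (Y i) (W j)) n)"
      by (rule sum_square_triangle[symmetric]) (rule vanish)
    also have "\<dots> = fps_nth (flt_bracket (\<Sum>i\<le>Suc n. Y i) (\<Sum>j\<le>Suc n. W j)) n"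
      by (simp only: flt_bracket_left.sum flt_bracket_right.sum fps_sum_nth) (rule sum.swap)
    also have "\<dots> = fps_nth (flt_bracket ?Y ?W) n"
      unfolding fps_nth_flt_bracket
      by (rule sum.cong[OF refl])
        (simp only: fps_sum_nth Y_nth[of _ n] W_nth[of _ "Suc n"] atMost_iff diff_le_self le_SucI)
    finally show "fps_nth (ddt ?W) n = fps_nth (flt_bracket ?Y ?W) n" .
  qed
qed

section \<open>The flow of a derivation\<close>

definition exp_neg_t :: "('a fl \<Rightarrow> 'a fl) \<Rightarrow> 'a fl fps \<Rightarrow> 'a fl fps" where
  "exp_neg_t D x = Abs_fps (\<lambda>n. \<Sum>k\<le>n. fl_scale ((-1) ^ k / fact k) ((D ^^ k) (fps_nth x (n - k))))"

lemma fps_nth_exp_neg_t: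
  "fps_nth (exp_neg_t D x) n = (\<Sum>k\<le>n. fl_scale ((-1) ^ k / fact k) ((D ^^ k) (fps_nth x (n - k))))"
  by (simp add: exp_neg_t_def)

lemma fps_nth_exp_neg_t_0 [simp]: "fps_nth (exp_neg_t D x) 0 = fps_nth x 0"
  by (simp add: fps_nth_exp_neg_t)

lemma FLt_exp_neg_t:
  assumes "\<And>x. x \<in> FL S \<Longrightarrow> D x \<in> FL S" "x \<in> FLt S"
  shows "exp_neg_t D x \<in> FLt S"
proof -
  have "(D ^^ k) y \<in> FL S" if "y \<in> FL S" for k y
    using that assms(1) by (induction k) auto
  then show ?thesis
    using assms(2) by (simp add: FLt_def fps_nth_exp_neg_t FL_sum FL_scale)
qed

context degree_raising_derivation
begin

lemma pow_add: "(D ^^ k) (x + y) = (D ^^ k) x + (D ^^ k) y"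
  by (induction k) (simp_all add: add)

lemma pow_scale: "(D ^^ k) (fl_scale c x) = fl_scale c ((D ^^ k) x)"
  by (induction k) (simp_all add: scale)

lemma pow_order: "fl_order_ge n x \<Longrightarrow> fl_order_ge n ((D ^^ k) x)"
proof (induction k)
  case (Suc k)
  then show ?case using order[of n "(D ^^ k) x"] by (simp add: fl_order_ge_def)
qed simp

lemma flt_map_bracket:
  "flt_map D (flt_bracket x y) = flt_bracket (flt_map D x) y + flt_bracket x (flt_map D y)"
  by (simp add: fps_eq_iff fps_nth_flt_bracket sum bracket sum.distrib)

lemma flt_map_scale: "flt_map D (flt_scale c x) = flt_scale c (flt_map D x)"
  by (simp add: fps_eq_iff fps_nth_flt_scale sum scale)

lemma exp_neg_t_add: "exp_neg_t D (x + y) = exp_neg_t D x + exp_neg_t D y"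
  by (simp add: fps_eq_iff fps_nth_exp_neg_t pow_add fl.scale_right_distrib sum.distrib)

sublocale exp_neg_t: additive "exp_neg_t D"
  by unfold_locales (rule exp_neg_t_add)

lemma exp_neg_t_map: "exp_neg_t D (flt_map D x) = flt_map D (exp_neg_t D x)"
  by (simp add: fps_eq_iff fps_nth_exp_neg_t sum scale funpow_swap1)

text \<open>
  This equation determines the coefficients of \<open>exp_neg_t D x\<close> recursively from its constant term; the
  algebraic properties below are proved by comparing derivatives, with no binomial expansion.
\<close>

lemma ddt_exp_neg_t: "ddt (exp_neg_t D x) = exp_neg_t D (ddt x) - flt_map D (exp_neg_t D x)"
proof (rule fps_ext)
  fix n
  let ?h = "\<lambda>i j. fl_scale ((-1) ^ i / fact i) ((D ^^ i) (fps_nth x j))"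
  have "of_nat (Suc i) * ((-1) ^ Suc i / fact (Suc i)) = (- ((-1) ^ i / fact i) :: rat)" for i
    by (simp add: field_simps del: of_nat_Suc)
  then have 1: "fl_scale (of_nat (Suc i)) (?h (Suc i) (n - i)) = - D (?h i (n - i))" for i
    by (simp only: fl.scale_scale scale) simp
  have 2: "fl_scale (of_nat (Suc (n - i))) (?h i (Suc (n - i)))
      = fl_scale ((-1) ^ i / fact i) ((D ^^ i) (fps_nth (ddt x) (n - i)))" for i
    by (simp add: fps_nth_ddt pow_scale mult.commute del: of_nat_Suc)
  have "fps_nth (ddt (exp_neg_t D x)) n = (\<Sum>i\<le>n. - D (?h i (n - i)))
      + (\<Sum>i\<le>n. fl_scale ((-1) ^ i / fact i) ((D ^^ i) (fps_nth (ddt x) (n - i))))"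
    unfolding fps_nth_ddt[of "exp_neg_t D x"] fps_nth_exp_neg_t fl.scale_sum_leibniz[of n ?h] 1 2 ..
  then show "fps_nth (ddt (exp_neg_t D x)) n
      = fps_nth (exp_neg_t D (ddt x) - flt_map D (exp_neg_t D x)) n"
    by (simp add: fps_nth_exp_neg_t sum sum_negf)
qed

lemma exp_neg_t_bracket:
  "exp_neg_t D (flt_bracket x y) = flt_bracket (exp_neg_t D x) (exp_neg_t D y)"
proof -
  have "fps_nth (exp_neg_t D (flt_bracket x y)) n
      = fps_nth (flt_bracket (exp_neg_t D x) (exp_neg_t D y)) n" for n
  proof (induction n arbitrary: x y)
    case 0
    then show ?case by (simp add: fps_nth_flt_bracket)
  next
    case (Suc n)
    have "ddt (flt_bracket (exp_neg_t D x) (exp_neg_t D y))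
        = flt_bracket (exp_neg_t D (ddt x)) (exp_neg_t D y)
          + flt_bracket (exp_neg_t D x) (exp_neg_t D (ddt y))
          - flt_map D (flt_bracket (exp_neg_t D x) (exp_neg_t D y))"
      by (simp add: ddt_bracket ddt_exp_neg_t flt_map_bracket flt_bracket_left.diff flt_bracket_right.diff)
    then show ?case
      by (intro fps_nth_Suc_eqI) (simp add: ddt_exp_neg_t ddt_bracket exp_neg_t_add Suc)
  qed
  then show ?thesis by (rule fps_ext)
qed

lemma exp_neg_t_scale: "exp_neg_t D (flt_scale c x) = flt_scale c (exp_neg_t D x)"
proof -
  have "fps_nth (exp_neg_t D (flt_scale c x)) n = fps_nth (flt_scale c (exp_neg_t D x)) n" for n
  proof (induction n arbitrary: c x)
    case 0
    then show ?case by (simp add: fps_nth_flt_scale)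
  next
    case (Suc n)
    have "flt_scale c (u - v) = flt_scale c u - flt_scale c v" for u v :: "'a fl fps"
      by (simp add: fps_eq_iff fps_nth_flt_scale fl.scale_right_diff_distrib sum_subtractf)
    then have "ddt (flt_scale c (exp_neg_t D x)) = flt_scale (fps_deriv c) (exp_neg_t D x)
        + flt_scale c (exp_neg_t D (ddt x)) - flt_map D (flt_scale c (exp_neg_t D x))"
      by (simp add: ddt_scale ddt_exp_neg_t flt_map_scale)
    then show ?case
      by (intro fps_nth_Suc_eqI) (simp add: ddt_exp_neg_t ddt_scale exp_neg_t_add Suc)
  qed
  then show ?thesis by (rule fps_ext)
qed

lemma uminus: "degree_raising_derivation (\<lambda>x. - D x)"
proof
  show "- D (x + y) = - D x + - D y" for x y by (simp add: add)
  show "- D (fl_scale c x) = fl_scale c (- D x)" for c x by (simp add: scale)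
  show "- D (fl_bracket x y) = fl_bracket (- D x) y + fl_bracket x (- D y)" for x y
    by (simp add: bracket fl_bracket_left.minus fl_bracket_right.minus)
  show "fl_order_ge n x \<Longrightarrow> fl_order_ge (Suc n) (- D x)" for n x
    by (simp add: order fl_order_ge_simps)
qed

lemma exp_neg_t_inverse: "exp_neg_t (\<lambda>x. - D x) (exp_neg_t D x) = x"
proof -
  interpret neg: degree_raising_derivation "\<lambda>x. - D x" by (rule uminus)
  have map_neg: "flt_map (\<lambda>x. - D x) y = - flt_map D y" for y
    by (simp add: fps_eq_iff)
  have "fps_nth (exp_neg_t (\<lambda>x. - D x) (exp_neg_t D x)) n = fps_nth x n" for n
  proof (induction n arbitrary: x)
    case (Suc n)
    have "ddt (exp_neg_t (\<lambda>x. - D x) (exp_neg_t D x)) = exp_neg_t (\<lambda>x. - D x) (exp_neg_t D (ddt x))"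
      using neg.exp_neg_t_map[of "exp_neg_t D x"]
      by (simp add: neg.ddt_exp_neg_t ddt_exp_neg_t neg.exp_neg_t.diff neg.exp_neg_t.minus map_neg)
    then show ?case
      by (intro fps_nth_Suc_eqI) (simp add: Suc)
  qed simp
  then show ?thesis by (rule fps_ext)
qed

lemma exp_neg_t_inverse': "exp_neg_t D (exp_neg_t (\<lambda>x. - D x) x) = x"
  using degree_raising_derivation.exp_neg_t_inverse[OF uminus] by simp

lemma flt_automorphism_exp_neg_t:
  assumes FL: "\<And>x. x \<in> FL S \<Longrightarrow> D x \<in> FL S"
  shows "flt_automorphism S (restrict (exp_neg_t D) (FLt S))"
  unfolding flt_automorphism_def flt_continuous_def
proof (intro conjI allI ballI)
  have FL': "\<And>x. x \<in> FL S \<Longrightarrow> - D x \<in> FL S" by (simp add: FL FL_uminus)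
  show "restrict (exp_neg_t D) (FLt S) \<in> FLt S \<rightarrow>\<^sub>E FLt S"
    by (simp add: FLt_exp_neg_t FL)
  have "bij_betw (exp_neg_t D) (FLt S) (FLt S)"
    by (rule bij_betwI[where g = "exp_neg_t (\<lambda>x. - D x)"])
      (simp_all add: FLt_exp_neg_t FL FL' exp_neg_t_inverse exp_neg_t_inverse')
  then show "bij_betw (restrict (exp_neg_t D) (FLt S)) (FLt S) (FLt S)"
    by (simp cong: bij_betw_cong)
  show "\<exists>d. \<forall>x\<in>FLt S. \<forall>y\<in>FLt S. (\<forall>k\<le>d. flt_part k x = flt_part k y) \<longrightarrow>
      (\<forall>k\<le>n. flt_part k (restrict (exp_neg_t D) (FLt S) x) = flt_part k (restrict (exp_neg_t D) (FLt S) y))" for n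
  proof (intro exI[of _ n] ballI impI)
    fix x y assume xy: "x \<in> FLt S" "y \<in> FLt S" "\<forall>k\<le>n. flt_part k x = flt_part k y"
    have "fl_order_ge (Suc n) (fps_nth (x - y) i)" for i
      using xy(3) by (auto simp: fl_order_ge_Suc fps_eq_iff)
    then have "fl_order_ge (Suc n) (fps_nth (exp_neg_t D (x - y)) i)" for i
      unfolding fps_nth_exp_neg_t by (intro fl_order_ge_sum fl_order_ge_simps pow_order)
    then have "fl_order_ge (Suc n) (fps_nth (exp_neg_t D x) i - fps_nth (exp_neg_t D y) i)" for i
      by (simp add: exp_neg_t.diff)
    then show "\<forall>k\<le>n. flt_part k (restrict (exp_neg_t D) (FLt S) x)
        = flt_part k (restrict (exp_neg_t D) (FLt S) y)"
      using xy by (simp add: fl_order_ge_Suc fps_eq_iff)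
  qed
qed (simp_all add: exp_neg_t_add exp_neg_t_scale exp_neg_t_bracket FLt_add FLt_scale FLt_bracket)

lemma exp_neg_t_eq_op_exp:
  "op_exp (\<lambda>x. flt_scale (- fps_X) (flt_map D x)) x = exp_neg_t D x"
proof -
  let ?T = "\<lambda>x. flt_scale (- fps_X) (flt_map D x)"
  have T_nth: "fps_nth (?T x) n = (if n = 0 then 0 else - D (fps_nth x (n - 1)))" for x n
    by (simp add: flt_scale_uminus fps_nth_flt_scale_X)
  have raising: "raising_op ?T"
  proof
    show "\<forall>i. fl_order_ge (Suc n) (fps_nth (?T x) i)" if "\<forall>i. fl_order_ge n (fps_nth x i)" for n x
      using that order by (simp add: T_nth fl_order_ge_simps)
  qed (auto simp: fps_eq_iff T_nth add scale zero)
  have pow: "fps_nth ((?T ^^ k) x) n = fl_scale ((-1) ^ k) ((D ^^ k) (fps_nth x (n - k)))" if "k \<le> n" for k n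
    using that
  proof (induction k arbitrary: n)
    case (Suc k)
    then show ?case by (simp add: T_nth scale)
  qed simp
  show ?thesis
    unfolding raising_op.op_series_eq[OF raising]
    by (simp add: fps_eq_iff op_sum_def fps_nth_exp_neg_t pow)
qed

end

lemma flt_decompose: "x = fps_const (fps_nth x 0) + flt_scale fps_X (fps_shift 1 x)"
  by (simp add: fps_eq_iff fps_nth_flt_scale_X)

lemma flt_bracket_const: "flt_bracket (fps_const x) (fps_const y) = fps_const (fl_bracket x y)"
proof -
  have "(\<Sum>i\<le>n. fl_bracket (if i = 0 then x else 0) (if n \<le> i then y else 0))
      = (\<Sum>i\<le>n. if i = 0 then if n = 0 then fl_bracket x y else 0 else 0)" for n :: nat
    by (rule sum.cong) (auto simp: fl_bracket_left.zero fl_bracket_right.zero)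
  then show ?thesis by (simp add: fps_eq_iff fps_nth_flt_bracket)
qed

lemma FLt_shift: "x \<in> FLt S \<Longrightarrow> fps_shift k x \<in> FLt S"
  by (simp add: FLt_def)

lemma flt_automorphism_unique:
  assumes F: "flt_automorphism S F" and F': "flt_automorphism S F'"
    and gen: "\<And>a. a \<in> S \<Longrightarrow> F (fps_const (fl_gen a)) = F' (fps_const (fl_gen a))"
  shows "F = F'"
proof (rule extensionalityI[of _ "FLt S"])
  show "F \<in> extensional (FLt S)" "F' \<in> extensional (FLt S)"
    using F F' by (auto simp: flt_automorphism_def PiE_def)
  have H_add: "H (x + y) = H x + H y" and H_scale: "H (flt_scale c x) = flt_scale c (H x)"
    and H_bracket: "H (flt_bracket x y) = flt_bracket (H x) (H y)"
    if "flt_automorphism S H" "x \<in> FLt S" "y \<in> FLt S" for H x y c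
    using that unfolding flt_automorphism_def by blast+
  have const_scale: "flt_scale (fps_const c) (fps_const x) = fps_const (fl_scale c x)" for c and x :: "'a fl"
    by (simp add: fps_eq_iff)
  have const: "F (fps_const x) = F' (fps_const x)" if x: "x \<in> FL S" for x
  proof (rule flt_eqI)
    fix n
    have "flt_continuous S F" "flt_continuous S F'"
      using F F' unfolding flt_automorphism_def by blast+
    then obtain d d' where d: "\<forall>x\<in>FLt S. \<forall>y\<in>FLt S. (\<forall>k\<le>d. flt_part k x = flt_part k y)
        \<longrightarrow> (\<forall>k\<le>n. flt_part k (F x) = flt_part k (F y))"
      and d': "\<forall>x\<in>FLt S. \<forall>y\<in>FLt S. (\<forall>k\<le>d'. flt_part k x = flt_part k y)
        \<longrightarrow> (\<forall>k\<le>n. flt_part k (F' x) = flt_part k (F' y))"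
      unfolding flt_continuous_def by blast
    from x have "\<exists>y\<in>FL S. F (fps_const y) = F' (fps_const y)
        \<and> (\<forall>k\<le>max d d'. fl_part k y = fl_part k x)"
    proof (induction rule: FL_trunc_induct)
      case zero
      show ?case
        using H_add[OF F, of 0 0] H_add[OF F', of 0 0] FLt_const[OF FL_zero, of S] by simp
    next
      case (add x y)
      then show ?case
        using H_add[OF F FLt_const FLt_const, of x y] H_add[OF F' FLt_const FLt_const, of x y]
        by (simp add: fps_const_add)
    next
      case (scale c x)
      then show ?case
        using H_scale[OF F FLt_const FLt_const, of x x "fps_const c"]
          H_scale[OF F' FLt_const FLt_const, of x x "fps_const c"]
        by (simp add: const_scale)
    next
      case (gen a)
      then show ?case by (rule assms(3))
    next
      case (bracket x y)
      then show ?case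
        using H_bracket[OF F FLt_const FLt_const, of x y] H_bracket[OF F' FLt_const FLt_const, of x y]
        by (simp add: flt_bracket_const)
    qed
    then obtain y where y: "y \<in> FL S" "F (fps_const y) = F' (fps_const y)"
        "\<forall>k\<le>max d d'. fl_part k y = fl_part k x"
      by blast
    have "flt_part k (fps_const y) = flt_part k (fps_const x)" if "k \<le> max d d'" for k
      using that y(3) by (simp add: fps_eq_iff)
    then have "flt_part n (F (fps_const y)) = flt_part n (F (fps_const x))"
      "flt_part n (F' (fps_const y)) = flt_part n (F' (fps_const x))"
      using d[rule_format, OF FLt_const[OF y(1)] FLt_const[OF x]]
        d'[rule_format, OF FLt_const[OF y(1)] FLt_const[OF x]] by simp_all
    then show "flt_part n (F (fps_const x)) = flt_part n (F' (fps_const x))"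
      using y(2) by simp
  qed
  have "fps_nth (F x) n = fps_nth (F' x) n" if "x \<in> FLt S" for x n
    using that
  proof (induction n arbitrary: x)
    have H: "fps_nth (H x) n = fps_nth (H (fps_const (fps_nth x 0))) n
        + (if n = 0 then 0 else fps_nth (H (fps_shift 1 x)) (n - 1))"
      if "flt_automorphism S H" "x \<in> FLt S" for H x n
    proof -
      have c: "fps_const (fps_nth x 0) \<in> FLt S" "fps_shift 1 x \<in> FLt S"
        using that(2) by (simp_all add: FLt_const FLt_nth FLt_shift)
      have "H x = H (fps_const (fps_nth x 0) + flt_scale fps_X (fps_shift 1 x))"
        using flt_decompose[of x] by simp
      also have "\<dots> = H (fps_const (fps_nth x 0)) + flt_scale fps_X (H (fps_shift 1 x))"
        using that(1) c by (simp add: H_add H_scale FLt_scale)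
      finally show ?thesis
        by (simp add: fps_nth_flt_scale_X)
    qed
    case (0 x)
    then show ?case
      using H[OF F 0, of 0] H[OF F' 0, of 0] const[OF FLt_nth] by simp
    case (Suc n x)
    then show ?case
      using H[OF F Suc(2), of "Suc n"] H[OF F' Suc(2), of "Suc n"] const[OF FLt_nth] 
      by (simp add: FLt_shift)
  qed
  then show "F x = F' x" if "x \<in> FLt S" for x
    using that by (intro fps_ext)
qed

section \<open>The differential equation for \<open>\<Gamma>\<close>\<close>

lemma fps_fixpoint_unique:
  assumes "\<And>g h n. (\<And>i. i < n \<Longrightarrow> fps_nth g i = fps_nth h i) \<Longrightarrow> fps_nth (\<Phi> g) n = fps_nth (\<Phi> h) n"
    and "\<Phi> g = g" "\<Phi> h = h"
  shows "g = h"
proof (rule fps_ext)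
  show "fps_nth g n = fps_nth h n" for n
  proof (induction n rule: less_induct)
    case (less n)
    then show ?case using assms(1)[of n g h] assms(2,3) by simp
  qed
qed

lemma fps_fixpoint_exists:
  fixes \<Phi> :: "'b::zero fps \<Rightarrow> 'b fps"
  assumes contr: "\<And>g h n. (\<And>i. i < n \<Longrightarrow> fps_nth g i = fps_nth h i)
      \<Longrightarrow> fps_nth (\<Phi> g) n = fps_nth (\<Phi> h) n"
    and K: "0 \<in> K" "\<And>g. \<forall>n. fps_nth g n \<in> K \<Longrightarrow> \<forall>n. fps_nth (\<Phi> g) n \<in> K"
  obtains g where "\<Phi> g = g" "\<forall>n. fps_nth g n \<in> K"
proof -
  define s where "s m = (\<Phi> ^^ m) 0" for m
  have s_Suc: "s (Suc m) = \<Phi> (s m)" for m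
    by (simp add: s_def)
  have "\<forall>n. fps_nth (s m) n \<in> K" for m
    by (induction m) (use K in \<open>simp_all add: s_def\<close>)
  then have sK: "fps_nth (s m) n \<in> K" for m n by blast
  have step: "i < m \<Longrightarrow> fps_nth (s m) i = fps_nth (s (Suc m)) i" for m i
  proof (induction m arbitrary: i)
    case (Suc m)
    then show ?case unfolding s_Suc[of m] s_Suc[of "Suc m"] by (intro contr) auto
  qed simp
  have stable: "fps_nth (s (Suc i + d)) i = fps_nth (s (Suc i)) i" for i d
  proof (induction d)
    case (Suc d)
    then show ?case using step[of i "Suc i + d"] by simp
  qed simp
  define g where "g = Abs_fps (\<lambda>n. fps_nth (s (Suc n)) n)"
  have "fps_nth g i = fps_nth (s n) i" if "i < n" for i n
    using stable[of i "n - Suc i"] that by (simp add: g_def)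
  then have "fps_nth (\<Phi> g) n = fps_nth g n" for n
    using contr[of n g "s n"] by (simp add: g_def s_Suc)
  then show thesis
    using that[of g] sK by (simp add: fps_eq_iff g_def)
qed

lemma flt_bracket_pow_cong:
  assumes "\<And>i. i \<le> n \<Longrightarrow> fps_nth g i = fps_nth h i"
  shows "i \<le> n \<Longrightarrow> fps_nth ((flt_bracket g ^^ k) c) i = fps_nth ((flt_bracket h ^^ k) c) i"
proof (induction k arbitrary: i)
  case (Suc k)
  then show ?case
    using assms by (auto simp: fps_nth_flt_bracket intro!: sum.cong)
qed simp

lemma op_sum_bracket_cong:
  assumes "\<And>i. i \<le> n \<Longrightarrow> fps_nth g i = fps_nth h i"
  shows "fps_nth (op_sum p (flt_bracket g) c) n = fps_nth (op_sum p (flt_bracket h) c) n"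
  unfolding op_sum_def by (simp add: flt_bracket_pow_cong[of n g h n, OF assms])

lemma FLt_op_sum_bracket:
  assumes "g \<in> FLt S" "c \<in> FLt S"
  shows "op_sum p (flt_bracket g) c \<in> FLt S"
proof -
  have "(flt_bracket g ^^ k) c \<in> FLt S" for k
    by (induction k) (use assms FLt_bracket in auto)
  then show ?thesis
    by (auto simp: FLt_def op_sum_def intro!: FL_sum FL_scale)
qed

lemma op_series_bracket: "fps_nth g 0 = 0 \<Longrightarrow> op_series p (flt_bracket g) c = op_sum p (flt_bracket g) c"
  by (rule raising_op.op_series_eq[OF raising_op_bracket])

lemma bracket_ode_unique_solution:
  assumes "c \<in> FLt S"
  shows "\<exists>!g. g \<in> FLt S \<and> fps_nth g 0 = 0 \<and> ddt g = op_series p (flt_bracket g) c"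
proof -
  define \<Phi> where "\<Phi> g = Abs_fps (\<lambda>n. case n of 0 \<Rightarrow> 0
    | Suc m \<Rightarrow> fl_scale (1 / of_nat (Suc m)) (fps_nth (op_sum p (flt_bracket g) c) m))" for g
  have contr: "fps_nth (\<Phi> g) n = fps_nth (\<Phi> h) n"
    if "\<And>i. i < n \<Longrightarrow> fps_nth g i = fps_nth h i" for g h n
  proof (cases n)
    case (Suc m)
    then show ?thesis
      using op_sum_bracket_cong[of m g h p c] that by (simp add: \<Phi>_def)
  qed (simp add: \<Phi>_def)
  have fixpoint: "fps_nth g 0 = 0 \<and> ddt g = op_series p (flt_bracket g) c \<longleftrightarrow> \<Phi> g = g" for g
  proof
    assume g: "fps_nth g 0 = 0 \<and> ddt g = op_series p (flt_bracket g) c"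
    then have "op_sum p (flt_bracket g) c = ddt g"
      by (simp add: op_series_bracket)
    then have "fps_nth (op_sum p (flt_bracket g) c) n
        = fl_scale (of_nat (Suc n)) (fps_nth g (Suc n))" for n
      by (simp only: fps_nth_ddt)
    then show "\<Phi> g = g"
      using g by (simp add: \<Phi>_def fps_eq_iff split: nat.split del: of_nat_Suc)
  next
    assume g: "\<Phi> g = g"
    have g0: "fps_nth g 0 = 0"
      by (subst g[symmetric]) (simp add: \<Phi>_def)
    have "fps_nth g (Suc n) = fl_scale (1 / of_nat (Suc n)) (fps_nth (op_sum p (flt_bracket g) c) n)" for n
      by (subst g[symmetric]) (simp add: \<Phi>_def)
    then have "ddt g = op_sum p (flt_bracket g) c"
      by (simp add: fps_eq_iff fps_nth_ddt del: of_nat_Suc)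
    then show "fps_nth g 0 = 0 \<and> ddt g = op_series p (flt_bracket g) c"
      using g0 by (simp add: op_series_bracket)
  qed
  obtain g where g: "\<Phi> g = g" "\<forall>n. fps_nth g n \<in> FL S"
  proof (rule fps_fixpoint_exists[of \<Phi> "FL S", OF contr FL_zero])
    fix g :: "'a fl fps" assume "\<forall>n. fps_nth g n \<in> FL S"
    then have "op_sum p (flt_bracket g) c \<in> FLt S"
      using assms by (intro FLt_op_sum_bracket) (auto simp: FLt_def)
    then show "\<forall>n. fps_nth (\<Phi> g) n \<in> FL S"
      by (auto simp: \<Phi>_def FLt_def FL_zero intro: FL_scale split: nat.split)
  qed
  show ?thesis
    unfolding fixpoint
  proof (rule ex1I[of _ g])
    show "g \<in> FLt S \<and> \<Phi> g = g" using g by (simp add: FLt_def)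
    show "h = g" if "h \<in> FLt S \<and> \<Phi> h = h" for h
      using fps_fixpoint_unique[of \<Phi> h g, OF contr] that g(1) by blast
  qed
qed

lemma linear_ode_unique:
  assumes "fps_nth u 0 = fps_nth v 0" "ddt u = flt_bracket y u" "ddt v = flt_bracket y v"
  shows "u = v"
proof (rule fps_ext)
  show "fps_nth u n = fps_nth v n" for n
  proof (induction n rule: less_induct)
    case (less n)
    show ?case
    proof (cases n)
      case (Suc m)
      have "fps_nth (ddt u) m = fps_nth (ddt v) m"
        unfolding assms(2,3) fps_nth_flt_bracket
        by (intro sum.cong refl) (simp add: less Suc)
      then show ?thesis unfolding Suc by (rule fps_nth_Suc_eqI)
    qed (simp add: assms(1))
  qed
qed

lemma bernoulli_series_mult:
  "Abs_fps (\<lambda>k. 1 / fact (Suc k)) * (fps_X / (fps_exp 1 - 1)) = (1 :: rat fps)"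
proof -
  let ?phi = "Abs_fps (\<lambda>k. 1 / fact (Suc k)) :: rat fps"
  have g: "fps_exp 1 - 1 = fps_X * ?phi"
    by (auto simp: fps_eq_iff simp del: fact_Suc)
  have "?phi * inverse ?phi = 1"
    using inverse_mult_eq_1[of ?phi] by (simp add: mult.commute)
  then have "fps_X = fps_X * ?phi * inverse ?phi"
    by (simp add: mult.assoc)
  then have "fps_X * ?phi dvd fps_X"
    by (rule dvdI)
  then have "fps_X / (fps_X * ?phi) * (fps_X * ?phi) = fps_X"
    by (rule dvd_div_mult_self)
  then have "(?phi * (fps_X / (fps_exp 1 - 1))) * fps_X = 1 * fps_X"
    unfolding g by (simp only: ac_simps mult_1 mult_1_right)
  then show ?thesis
    using mult_right_cancel[of "fps_X :: rat fps"] by simp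
qed

theorem proposition2p6:
  fixes S :: "'a set" and lam :: "'a \<Rightarrow> 'a fl"
  assumes "finite S" and "lam \<in> S \<rightarrow> FL S"
  shows "exp_neg_t_tder S lam = C_aut S (Gamma_sol S lam)"
proof -
  obtain D where D: "degree_raising_derivation D" and FL: "\<And>x. x \<in> FL S \<Longrightarrow> D x \<in> FL S"
    and gen: "\<And>a. a \<in> S \<Longrightarrow> D (fl_gen a) = fl_bracket (fl_gen a) (lam a)"
    and tder: "tder S lam = restrict D (FL S)"
    using tder_exists[OF assms(2)] by blast
  interpret degree_raising_derivation D by (rule D)
  let ?E = "exp_neg_t D"
  have E: "exp_neg_t_tder S lam = restrict ?E (FLt S)"
    unfolding exp_neg_t_tder_def
  proof (rule restrict_ext)
    fix x assume x: "x \<in> FLt S"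
    let ?T = "\<lambda>x. flt_scale (- fps_X) (flt_map D x)"
    let ?T' = "\<lambda>x. flt_scale (- fps_X) (flt_map (tder S lam) x)"
    have "(?T' ^^ k) x = (?T ^^ k) x \<and> (?T ^^ k) x \<in> FLt S" for k
    proof (induction k)
      case (Suc k)
      then have "flt_map (tder S lam) ((?T ^^ k) x) = flt_map D ((?T ^^ k) x)"
        by (simp add: fps_eq_iff tder FLt_nth)
      moreover have "flt_map D ((?T ^^ k) x) \<in> FLt S"
        using Suc FL by (simp add: FLt_def)
      ultimately show ?case
        using Suc by (simp add: FLt_scale)
    qed (simp add: x)
    then have "op_exp ?T' x = op_exp ?T x"
      by (simp add: op_series_def)
    then show "op_exp ?T' x = ?E x"
      by (simp add: exp_neg_t_eq_op_exp)
  qed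
  define G where "G = Gamma_sol S lam"
  let ?psi = "fps_X / (fps_exp 1 - 1) :: rat fps"
  have c: "fps_const (lam a) \<in> FLt S" if "a \<in> S" for a
    using assms(2) that by (auto intro: FLt_const)
  have ex1: "\<exists>!g. g \<in> FLt S \<and> fps_nth g 0 = 0
      \<and> ddt g = op_series ?psi (flt_bracket g) (?E (fps_const (lam a)))" if "a \<in> S" for a
    by (rule bracket_ode_unique_solution) (simp add: FLt_exp_neg_t FL c that)
  have ODE: "Gamma_ODE S lam H \<longleftrightarrow> (\<forall>a\<in>S. fps_nth (H a) 0 = 0
      \<and> ddt (H a) = op_series ?psi (flt_bracket (H a)) (?E (fps_const (lam a))))" for H
    unfolding Gamma_ODE_def E using c by simp
  have "\<exists>!G. G \<in> S \<rightarrow>\<^sub>E FLt S \<and> Gamma_ODE S lam G"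
  proof (rule ex_ex1I)
    from ex1 obtain g where "\<And>a. a \<in> S \<Longrightarrow> g a \<in> FLt S \<and> fps_nth (g a) 0 = 0
      \<and> ddt (g a) = op_series ?psi (flt_bracket (g a)) (?E (fps_const (lam a)))"
      by metis
    then show "\<exists>G. G \<in> S \<rightarrow>\<^sub>E FLt S \<and> Gamma_ODE S lam G"
      by (intro exI[of _ "restrict g S"]) (simp add: ODE)
  next
    fix G H
    assume G: "G \<in> S \<rightarrow>\<^sub>E FLt S \<and> Gamma_ODE S lam G" and H: "H \<in> S \<rightarrow>\<^sub>E FLt S \<and> Gamma_ODE S lam H"
    show "G = H"
    proof (rule PiE_ext)
      show "G a = H a" if "a \<in> S" for a
        using ex1[OF that] G H that unfolding ODE by blast
    qed (use G H in blast)+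
  qed
  then have "G \<in> S \<rightarrow>\<^sub>E FLt S \<and> Gamma_ODE S lam G"
    unfolding G_def Gamma_sol_def by (rule theI')
  then have G0: "fps_nth (G a) 0 = 0"
    and ddt_G: "ddt (G a) = op_sum ?psi (flt_bracket (G a)) (?E (fps_const (lam a)))" if "a \<in> S" for a
    using that by (simp_all add: ODE op_series_bracket)
  have E_gen: "?E (fps_const (fl_gen a)) = op_exp (flt_bracket (G a)) (fps_const (fl_gen a))"
    if a: "a \<in> S" for a
  proof -
    interpret raising_op "flt_bracket (G a)" by (rule raising_op_bracket[OF G0[OF a]])
    let ?y = "?E (fps_const (lam a))"
    have "op_sum (Abs_fps (\<lambda>k. 1 / fact (Suc k))) (flt_bracket (G a)) (ddt (G a)) = ?y"
      unfolding ddt_G[OF a] op_sum_comp bernoulli_series_mult op_sum_1 ..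
    then have W: "ddt (op_exp (flt_bracket (G a)) (fps_const (fl_gen a)))
        = flt_bracket ?y (op_exp (flt_bracket (G a)) (fps_const (fl_gen a)))"
      using ddt_exp_ad[OF G0[OF a], of "fl_gen a"] by (simp add: op_series_eq)
    have "flt_map D (fps_const (fl_gen a)) = flt_bracket (fps_const (fl_gen a)) (fps_const (lam a))"
      using a by (simp add: fps_eq_iff flt_bracket_const gen zero)
    then have "ddt (?E (fps_const (fl_gen a))) = - flt_bracket (?E (fps_const (fl_gen a))) ?y"
      by (simp add: ddt_exp_neg_t exp_neg_t.zero exp_neg_t_bracket flip: exp_neg_t_map)
    also have "\<dots> = flt_bracket ?y (?E (fps_const (fl_gen a)))"
      by (rule flt_bracket_swap[symmetric])
    finally show ?thesis
      using W by (rule linear_ode_unique[rotated]) (simp add: op_series_eq op_sum_nth[of 0 0])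
  qed
  have aut: "flt_automorphism S (restrict ?E (FLt S))"
    by (rule flt_automorphism_exp_neg_t[OF FL])
  have on_gen: "restrict ?E (FLt S) (fps_const (fl_gen a)) = op_exp (flt_bracket (G a)) (fps_const (fl_gen a))"
    if "a \<in> S" for a
    using E_gen[OF that] FLt_const[OF FL_gen[OF that]] by simp
  have "C_aut S G = restrict ?E (FLt S)"
    unfolding C_aut_def
  proof (rule the_equality)
    fix F
    assume F: "flt_automorphism S F
        \<and> (\<forall>a\<in>S. F (fps_const (fl_gen a)) = op_exp (flt_bracket (G a)) (fps_const (fl_gen a)))"
    show "F = restrict ?E (FLt S)"
      using F on_gen by (intro flt_automorphism_unique[OF _ aut]) auto
  qed (use aut on_gen in blast)
  then show ?thesis
    by (simp add: E G_def)
qed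

end
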